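(* Assume A1 (the Hessian of $f$ is $L$-Lipschitz) and A2 ($\nabla^2f(x)\succeq\mu I$ for all $x\in Q$, for some $\mu>0$). Let $\tau_0>0$, $\epsilon>0$, $m\in\mathbb{N}\setminus\{0\}$, and $$\kappa:=\frac{\mu^2}{2}\Bigl[3\cdot2^6\Bigl(\frac23\Bigr)^{1/3}m\max\{\tau_0,L\}+8L+\frac{c^2L^2m}{\tau_0}\Bigr]^{-1},\qquad c:=\frac{1}{3^{1/6}\,2^{13/6}}.$$ Let $x_0\in\mathcal{Q}_{\epsilon,\kappa}:=\{x\in Q:\ \epsilon\le\|F'(x)\|\le\frac{\kappa}{2}\}$. Let $\{x_k\}_{k\ge1}$ be generated by the algorithm First-Order CNM (described in the context) with inputs $x_0,\tau_0,\epsilon,m$, and let $T(\epsilon)\le+\infty$ be the first iteration index such that $\|\nabla f(x_{T(\epsilon)})+\psi'(x_{T(\epsilon)})\|\le\epsilon$ for a certain $\psi'(x_{T(\epsilon)})\in\partial\psi(x_{T(\epsilon)})$. Then $$T(\epsilon)\;\le\;\frac{1}{\log_2(1+m)}\,\log_2\log_2\frac{\kappa}{\epsilon}+1.$$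
   Context: Setting: $\|\cdot\|$ is the Euclidean norm for vectors and the spectral norm for matrices; $e_1,\dots,e_n$ is the standard basis of $\mathbb{R}^n$; $I$ is the identity matrix. $f:\mathbb{R}^n\to\mathbb{R}$ is twice continuously differentiable, $\psi:\mathbb{R}^n\to\mathbb{R}\cup\{+\infty\}$ is proper, closed and convex (possibly non-differentiable), $Q=\operatorname{dom}\psi$, $F=f+\psi$, and $F^\star=\inf_{x\in Q}F(x)>-\infty$. $\partial F(x)=\nabla f(x)+\partial\psi(x)$, and $F'(x)\in\partial F(x)$ denotes a given selection of subgradients. Assumption A1: $\|\nabla^2 f(y)-\nabla^2 f(x)\|\le L\|y-x\|$ for all $x,y\in\mathbb{R}^n$, where $L\ge 0$. Assumption A2: $\nabla^2f(x)\succeq\mu I$ for all $x\in Q$, for some $\mu>0$. Procedure CubicSteps$(x,B,\sigma,m,\epsilon)$ ($x\in Q$, $B=B^\top\in\mathbb{R}^{n\times n}$, $\sigma>0$, $m\ge1$, $\epsilon>0$): Step 0: set $x_0:=x$, $t:=0$. Step 1: if $t=m$, stop and return $(x_t,\text{success})$. Step 2: with $M_{x_t,\sigma}(y)=f(x_t)+\langle\nabla f(x_t),y-x_t\rangle+\frac12\langle B(y-x_t),y-x_t\rangle+\frac{\sigma}{6}\|y-x_t\|^3$, compute $x_{t+1}\in Q$ as an approximate minimizer of $M_{x_t,\sigma}+\psi$ over $Q$ such that $M_{x_t,\sigma}(x_{t+1})+\psi(x_{t+1})\le F(x_t)$ and $\|\nabla M_{x_t,\sigma}(x_{t+1})+\psi'(x_{t+1})\|\le\frac{\sigma}{4}\|x_{t+1}-x_t\|^2$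 for some $\psi'(x_{t+1})\in\partial\psi(x_{t+1})$. Step 3: if $\|\nabla f(x_{t+1})+\psi'(x_{t+1})\|\le\epsilon$ (same subgradient), stop and return $(x_{t+1},\text{solution})$. Step 4: if $F(x_0)-F(x_{t+1})\ge\frac{\epsilon^{3/2}}{384\,\sigma^{1/2}}(t+1)$, set $t:=t+1$ and go to Step 1; otherwise stop and return $(x_{t+1},\text{halt})$. Algorithm First-Order CNM: Step 0: given $x_0\in Q$, $\tau_0>0$, $\epsilon>0$, $m\ge1$, set $k:=0$. Step 1: set $\ell:=0$. Step 1.1: with $\sigma_{k,\ell}=2^4(2/3)^{1/3}(2^\ell\tau_k)m$ and $h_{k,\ell}=\Bigl[\frac{3\,\sigma_{k,\ell}^{3/2}\epsilon^{3/2}}{2^7\cdot192\,n^{3/2}(2^\ell\tau_k)^3}\Bigr]^{1/3}$, compute $B_{k,\ell}=\frac12(A_{k,\ell}+A_{k,\ell}^\top)$, where the $i$-th column of $A_{k,\ell}$ is $\frac{\nabla f(x_k+h_{k,\ell}e_i)-\nabla f(x_k)}{h_{k,\ell}}$. Step 1.2: $(\hat x_{k,\ell},\alpha_{k,\ell}):=$ CubicSteps$(x_k,B_{k,\ell},\sigma_{k,\ell},m,\epsilon)$. Step 2: if $\alpha_{k,\ell}=\text{halt}$, set $\ell:=\ell+1$ and go to Step 1.1. Step 3: let $\ell_k$ be the current $\ell$ and set $x_{k+1}=\hat x_{k,\ell_k}$. Step 4: if $\alpha_{k,\ell_k}=\text{success}$, set $\tau_{k+1}=\max\{\tau_0,2^{\ell_k-1}\tau_k\}$,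 $k:=k+1$, and go to Step 1; otherwise stop. *)

theory Defs
  imports "HOL-Analysis.Analysis"
begin

definition grad :: "(real^'n \<Rightarrow> real) \<Rightarrow> real^'n \<Rightarrow> real^'n" where
  "grad f x = (THE g. GDERIV f x :> g)"

definition hess :: "(real^'n \<Rightarrow> real) \<Rightarrow> real^'n \<Rightarrow> real^'n^'n" where
  "hess f x = matrix (frechet_derivative (grad f) (at x))"

definition twice_cont_differentiable :: "(real^'n \<Rightarrow> real) \<Rightarrow> bool" where
  "twice_cont_differentiable f \<longleftrightarrow>
     (\<forall>x. f differentiable (at x)) \<and>
     (\<forall>x. grad f differentiable (at x)) \<and>
     continuous_on UNIV (hess f)"

definition spectral_norm :: "real^'n^'n \<Rightarrow> real" where
  "spectral_norm A = onorm (\<lambda>v. A *v v)"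

text \<open>The order is used only for symmetric matrices (Hessians of twice continuously
  differentiable functions and multiples of the identity).\<close>

definition loewner_le :: "real^'n^'n \<Rightarrow> real^'n^'n \<Rightarrow> bool" where
  "loewner_le A B \<longleftrightarrow> (\<forall>v. v \<bullet> (A *v v) \<le> v \<bullet> (B *v v))"

definition eff_dom :: "(real^'n \<Rightarrow> ereal) \<Rightarrow> (real^'n) set" where
  "eff_dom \<psi> = {x. \<psi> x < \<infinity>}"

definition ereal_epigraph :: "(real^'n \<Rightarrow> ereal) \<Rightarrow> ((real^'n) \<times> real) set" where
  "ereal_epigraph \<psi> = {(x, r). \<psi> x \<le> ereal r}"

definition proper_closed_convex :: "(real^'n \<Rightarrow> ereal) \<Rightarrow> bool" where
  "proper_closed_convex \<psi> \<longleftrightarrow>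
     (\<forall>x. \<psi> x \<noteq> -\<infinity>) \<and> eff_dom \<psi> \<noteq> {} \<and>
     closed (ereal_epigraph \<psi>) \<and> convex (ereal_epigraph \<psi>)"

definition subdiff :: "(real^'n \<Rightarrow> ereal) \<Rightarrow> real^'n \<Rightarrow> (real^'n) set" where
  "subdiff \<psi> x = {g. x \<in> eff_dom \<psi> \<and> (\<forall>y. \<psi> x + ereal (g \<bullet> (y - x)) \<le> \<psi> y)}"

definition obj :: "(real^'n \<Rightarrow> real) \<Rightarrow> (real^'n \<Rightarrow> ereal) \<Rightarrow> real^'n \<Rightarrow> ereal" where
  "obj f \<psi> x = ereal (f x) + \<psi> x"

definition obj_subdiff ::
  "(real^'n \<Rightarrow> real) \<Rightarrow> (real^'n \<Rightarrow> ereal) \<Rightarrow> real^'n \<Rightarrow> (real^'n) set" where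
  "obj_subdiff f \<psi> x = (\<lambda>g. grad f x + g) ` subdiff \<psi> x"

definition subgradient_selection ::
  "(real^'n \<Rightarrow> real) \<Rightarrow> (real^'n \<Rightarrow> ereal) \<Rightarrow> (real^'n \<Rightarrow> real^'n) \<Rightarrow> bool" where
  "subgradient_selection f \<psi> F' \<longleftrightarrow>
     (\<forall>x. obj_subdiff f \<psi> x \<noteq> {} \<longrightarrow> F' x \<in> obj_subdiff f \<psi> x)"

datatype status = Success | Solution | Halt

definition cubic_model ::
  "(real^'n \<Rightarrow> real) \<Rightarrow> real^'n^'n \<Rightarrow> real \<Rightarrow> real^'n \<Rightarrow> real^'n \<Rightarrow> real" where
  "cubic_model f B \<sigma> x y =
     f x + grad f x \<bullet> (y - x) + 1/2 * ((B *v (y - x)) \<bullet> (y - x)) + \<sigma> / 6 * norm (y - x) ^ 3"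

text \<open>\<open>cubic_step f \<psi> B \<sigma> x y g\<close>: the point \<open>y\<close> is an admissible inexact minimizer of the
  regularized model at \<open>x\<close>, certified by the subgradient \<open>g\<close> of \<open>\<psi>\<close> at \<open>y\<close>.\<close>

definition cubic_step ::
  "(real^'n \<Rightarrow> real) \<Rightarrow> (real^'n \<Rightarrow> ereal) \<Rightarrow> real^'n^'n \<Rightarrow> real \<Rightarrow>
   real^'n \<Rightarrow> real^'n \<Rightarrow> real^'n \<Rightarrow> bool" where
  "cubic_step f \<psi> B \<sigma> x y g \<longleftrightarrow>
     y \<in> eff_dom \<psi> \<and>
     ereal (cubic_model f B \<sigma> x y) + \<psi> y \<le> obj f \<psi> x \<and>
     g \<in> subdiff \<psi> y \<and>
     norm (grad (cubic_model f B \<sigma> x) y + g) \<le> \<sigma> / 4 * norm (y - x) ^ 2"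

text \<open>\<open>cubic_steps_from f \<psi> B \<sigma> m \<epsilon> x0 t x (y, s)\<close>: entering Step 1 with counter \<open>t\<close> and current
  point \<open>x\<close>, the procedure started at \<open>x0\<close> may return \<open>y\<close> with status \<open>s\<close>.  It is a relation
  because the inexact minimizers are not determined uniquely.\<close>

inductive cubic_steps_from ::
  "(real^'n \<Rightarrow> real) \<Rightarrow> (real^'n \<Rightarrow> ereal) \<Rightarrow> real^'n^'n \<Rightarrow> real \<Rightarrow> nat \<Rightarrow> real \<Rightarrow> real^'n \<Rightarrow>
   nat \<Rightarrow> real^'n \<Rightarrow> (real^'n) \<times> status \<Rightarrow> bool"
  for f \<psi> B \<sigma> m \<epsilon> x0 where
  success: "cubic_steps_from f \<psi> B \<sigma> m \<epsilon> x0 m x (x, Success)"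
| solution: "cubic_steps_from f \<psi> B \<sigma> m \<epsilon> x0 t x (y, Solution)"
    if "t \<noteq> m" "cubic_step f \<psi> B \<sigma> x y g" "norm (grad f y + g) \<le> \<epsilon>"
| continue: "cubic_steps_from f \<psi> B \<sigma> m \<epsilon> x0 t x r"
    if "t \<noteq> m" "cubic_step f \<psi> B \<sigma> x y g" "\<not> norm (grad f y + g) \<le> \<epsilon>"
       "obj f \<psi> x0 - obj f \<psi> y
          \<ge> ereal (\<epsilon> powr (3/2) / (384 * \<sigma> powr (1/2)) * real (t + 1))"
       "cubic_steps_from f \<psi> B \<sigma> m \<epsilon> x0 (t + 1) y r"
| halt: "cubic_steps_from f \<psi> B \<sigma> m \<epsilon> x0 t x (y, Halt)"
    if "t \<noteq> m" "cubic_step f \<psi> B \<sigma> x y g" "\<not> norm (grad f y + g) \<le> \<epsilon>"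
       "\<not> obj f \<psi> x0 - obj f \<psi> y
          \<ge> ereal (\<epsilon> powr (3/2) / (384 * \<sigma> powr (1/2)) * real (t + 1))"

definition cubic_steps ::
  "(real^'n \<Rightarrow> real) \<Rightarrow> (real^'n \<Rightarrow> ereal) \<Rightarrow> real^'n \<Rightarrow> real^'n^'n \<Rightarrow> real \<Rightarrow> nat \<Rightarrow> real \<Rightarrow>
   (real^'n) \<times> status \<Rightarrow> bool" where
  "cubic_steps f \<psi> x B \<sigma> m \<epsilon> r \<longleftrightarrow> cubic_steps_from f \<psi> B \<sigma> m \<epsilon> x 0 x r"

text \<open>In \<open>cnm_sigma\<close> and \<open>cnm_h\<close>, \<open>\<tau>\<close> stands for the trial value \<open>2 ^ l * \<tau>\<^sub>k\<close>.\<close>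

definition cnm_sigma :: "nat \<Rightarrow> real \<Rightarrow> real" where
  "cnm_sigma m \<tau> = 2 ^ 4 * root 3 (2/3) * \<tau> * real m"

definition cnm_h :: "nat \<Rightarrow> nat \<Rightarrow> real \<Rightarrow> real \<Rightarrow> real" where
  "cnm_h n m \<epsilon> \<tau> =
     root 3 (3 * cnm_sigma m \<tau> powr (3/2) * \<epsilon> powr (3/2) /
             (2 ^ 7 * 192 * real n powr (3/2) * \<tau> ^ 3))"

definition fd_matrix :: "(real^'n \<Rightarrow> real) \<Rightarrow> real^'n \<Rightarrow> real \<Rightarrow> real^'n^'n" where
  "fd_matrix f x h = (\<chi> j i. ((grad f (x + h *\<^sub>R axis i 1) - grad f x) /\<^sub>R h) $ j)"

definition fd_hess :: "(real^'n \<Rightarrow> real) \<Rightarrow> real^'n \<Rightarrow> real \<Rightarrow> real^'n^'n" where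
  "fd_hess f x h = (1/2) *\<^sub>R (fd_matrix f x h + transpose (fd_matrix f x h))"

text \<open>A run is recorded by total functions: the outer iterates \<open>x k\<close>, the estimates \<open>\<tau> k\<close>, and
  the results \<open>xh k l\<close>, \<open>\<alpha> k l\<close> of the inner trials.  Only the entries the algorithm actually
  reaches are constrained; the others are irrelevant.  Trial \<open>l\<close> of outer iteration \<open>k\<close> is reached
  iff the iteration is started and all earlier trials halted, and it is the last one iff it does
  not halt itself.  An endless inner loop is not excluded; in that case \<open>x (k + 1)\<close> is not
  generated.\<close>

definition trial_reached :: "(nat \<Rightarrow> nat \<Rightarrow> status) \<Rightarrow> nat \<Rightarrow> nat \<Rightarrow> bool" where
  "trial_reached \<alpha> k l \<longleftrightarrow> (\<forall>j<l. \<alpha> k j = Halt)"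

definition trial_accepted :: "(nat \<Rightarrow> nat \<Rightarrow> status) \<Rightarrow> nat \<Rightarrow> nat \<Rightarrow> bool" where
  "trial_accepted \<alpha> k l \<longleftrightarrow> trial_reached \<alpha> k l \<and> \<alpha> k l \<noteq> Halt"

primrec iteration_started :: "(nat \<Rightarrow> nat \<Rightarrow> status) \<Rightarrow> nat \<Rightarrow> bool" where
  "iteration_started \<alpha> 0 \<longleftrightarrow> True"
| "iteration_started \<alpha> (Suc k) \<longleftrightarrow>
     iteration_started \<alpha> k \<and> (\<exists>l. trial_accepted \<alpha> k l \<and> \<alpha> k l = Success)"

text \<open>The iterate \<open>x (k + 1)\<close> also exists if iteration \<open>k\<close> ends with a solution and the algorithm
  stops.\<close>

primrec iterate_generated :: "(nat \<Rightarrow> nat \<Rightarrow> status) \<Rightarrow> nat \<Rightarrow> bool" where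
  "iterate_generated \<alpha> 0 \<longleftrightarrow> True"
| "iterate_generated \<alpha> (Suc k) \<longleftrightarrow> iteration_started \<alpha> k \<and> (\<exists>l. trial_accepted \<alpha> k l)"

definition first_order_cnm ::
  "(real^'n \<Rightarrow> real) \<Rightarrow> (real^'n \<Rightarrow> ereal) \<Rightarrow> real^'n \<Rightarrow> real \<Rightarrow> real \<Rightarrow> nat \<Rightarrow>
   (nat \<Rightarrow> real^'n) \<Rightarrow> (nat \<Rightarrow> real) \<Rightarrow> (nat \<Rightarrow> nat \<Rightarrow> real^'n) \<Rightarrow> (nat \<Rightarrow> nat \<Rightarrow> status) \<Rightarrow> bool" where
  "first_order_cnm f \<psi> x0 \<tau>0 \<epsilon> m x \<tau> xh \<alpha> \<longleftrightarrow>
     x 0 = x0 \<and> \<tau> 0 = \<tau>0 \<and>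
     (\<forall>k. iteration_started \<alpha> k \<longrightarrow>
        (\<forall>l. trial_reached \<alpha> k l \<longrightarrow>
           cubic_steps f \<psi> (x k)
             (fd_hess f (x k) (cnm_h CARD('n) m \<epsilon> (2 ^ l * \<tau> k)))
             (cnm_sigma m (2 ^ l * \<tau> k)) m \<epsilon> (xh k l, \<alpha> k l)) \<and>
        (\<forall>l. trial_accepted \<alpha> k l \<longrightarrow>
           x (Suc k) = xh k l \<and>
           (\<alpha> k l = Success \<longrightarrow> \<tau> (Suc k) = max \<tau>0 (2 powi (int l - 1) * \<tau> k))))"

text \<open>The infimum of the empty set in \<open>enat\<close> is \<open>\<infinity>\<close>.\<close>

definition first_hit ::
  "(real^'n \<Rightarrow> real) \<Rightarrow> (real^'n \<Rightarrow> ereal) \<Rightarrow> real \<Rightarrow>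
   (nat \<Rightarrow> real^'n) \<Rightarrow> (nat \<Rightarrow> nat \<Rightarrow> status) \<Rightarrow> enat" where
  "first_hit f \<psi> \<epsilon> x \<alpha> =
     Inf {enat k | k. iterate_generated \<alpha> k \<and> (\<exists>g\<in>subdiff \<psi> (x k). norm (grad f (x k) + g) \<le> \<epsilon>)}"

definition kappa :: "real \<Rightarrow> real \<Rightarrow> nat \<Rightarrow> real \<Rightarrow> real" where
  "kappa \<mu> L m \<tau>0 =
     (let c = 1 / (3 powr (1/6) * 2 powr (13/6))
      in \<mu>\<^sup>2 / 2 * inverse (3 * 2 ^ 6 * root 3 (2/3) * real m * max \<tau>0 L + 8 * L
                        + c\<^sup>2 * L\<^sup>2 * real m / \<tau>0))"

text \<open>Points without subgradients are excluded: there \<open>F' x\<close> is not a subgradient.\<close>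

definition conv_region ::
  "(real^'n \<Rightarrow> real) \<Rightarrow> (real^'n \<Rightarrow> ereal) \<Rightarrow> (real^'n \<Rightarrow> real^'n) \<Rightarrow> real \<Rightarrow> real \<Rightarrow> (real^'n) set" where
  "conv_region f \<psi> F' \<epsilon> \<kappa> =
     {x \<in> eff_dom \<psi>. obj_subdiff f \<psi> x \<noteq> {} \<and> \<epsilon> \<le> norm (F' x) \<and> norm (F' x) \<le> \<kappa> / 2}"

end

theory Submission
  imports Defs
begin

text \<open>
  Let \<open>d\<^sub>t\<close> be the length of the \<open>t\<close>-th inner step.  The model Hessian differs from the Hessian at
  the current point by at most \<open>b + L (d\<^sub>0 + \<dots> + d\<^sub>t\<^sub>-\<^sub>1)\<close>, where \<open>b\<close> is the finite-difference error.

  If the trial value is at least \<open>L\<close>, then \<open>\<sigma>\<close> exceeds a multiple of \<open>L m\<close>, so that the sums over \<open>t\<close>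
  of the errors caused by keeping the Hessian of the first point are dominated by \<open>\<sigma> \<Sum> d\<^sub>t\<^sup>3\<close>
  in the decrease of the objective and by \<open>\<sigma> \<Sum> d\<^sub>t\<^sup>2\<close> in the gradient bounds.  Hence such a trial never
  halts, all estimates \<open>\<tau>\<^sub>k\<close> stay below \<open>max \<tau>\<^sub>0 L\<close>, and accepted trial values below twice that.

  Strong convexity at the first point and monotonicity of the subdifferential give
  \<open>d\<^sub>t \<le> 8 / (5 \<mu>) g\<^sub>t\<close>, where \<open>g\<^sub>t\<close> is the norm of the subgradient.  The gradient bound then becomes
  \<open>g\<^sub>t\<^sub>+\<^sub>1 \<le> g\<^sub>t g\<^sub>0 / \<kappa>\<close>, so \<open>m\<close> successful steps raise \<open>g\<^sub>0 / \<kappa>\<close> to the power \<open>m + 1\<close>.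
\<close>

section \<open>Gradients and Hessians\<close>

lemma GDERIV_unique:
  assumes "GDERIV f x :> g" "GDERIV f x :> g'"
  shows "g = g'"
proof -
  have "(\<lambda>h. h \<bullet> g) = (\<lambda>h. h \<bullet> g')"
    using assms unfolding gderiv_def by (rule has_derivative_unique)
  then have "(g - g') \<bullet> g = (g - g') \<bullet> g'"
    by meson
  then have "(g - g') \<bullet> (g - g') = 0"
    by (simp add: inner_diff_right)
  then show ?thesis by simp
qed

lemma grad_eqI: "GDERIV f x :> g \<Longrightarrow> grad f x = g"
  unfolding grad_def using GDERIV_unique by blast

lemma differentiable_imp_GDERIV_grad:
  fixes f :: "real^'n \<Rightarrow> real"
  assumes "f differentiable (at x)"
  shows "GDERIV f x :> grad f x"
proof -
  from assms obtain D where D: "(f has_derivative D) (at x)"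
    unfolding differentiable_def by blast
  then have "linear D" by (rule has_derivative_linear)
  \<comment> \<open>Riesz representation: the vector that represents the functional \<open>D\<close>
    is its adjoint evaluated at 1.\<close>
  then have "D = (\<lambda>h. h \<bullet> adjoint D 1)"
    using adjoint_works[of D _ 1] by (auto simp: fun_eq_iff inner_real_def)
  with D have "GDERIV f x :> adjoint D 1"
    unfolding gderiv_def by simp
  then show ?thesis using grad_eqI by metis
qed

lemma DERIV_along_line:
  assumes "GDERIV f (x + s *\<^sub>R v) :> g"
  shows "((\<lambda>s. f (x + s *\<^sub>R v)) has_real_derivative (g \<bullet> v)) (at s)"
proof -
  have "((\<lambda>s. x + s *\<^sub>R v) has_derivative (\<lambda>h. h *\<^sub>R v)) (at s)"
    by (auto intro!: derivative_eq_intros)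
  from has_derivative_compose[OF this assms[unfolded gderiv_def]]
  show ?thesis
    unfolding has_field_derivative_def by (simp add: inner_commute mult_commute_abs)
qed

text \<open>The norm is not differentiable at the origin, so the chain rule covers only nonzero
  points. At 0 the difference quotient equals \<open>norm y ^ 2\<close>.\<close>

lemma GDERIV_norm_cube: "GDERIV (\<lambda>z. norm z ^ 3) z :> (3 * norm z) *\<^sub>R (z :: 'a :: real_inner)"
proof (cases "z = 0")
  case True
  have "((\<lambda>y::'a. norm y ^ 3) has_derivative (\<lambda>h. 0)) (at 0)"
  proof (rule has_derivativeI)
    have "((\<lambda>y::'a. norm y ^ 2) \<longlongrightarrow> norm (0::'a) ^ 2) (at 0)"
      by (intro tendsto_intros)
    moreover have "\<forall>\<^sub>F y in at (0::'a). norm y ^ 2 = (norm y ^ 3 - norm (0::'a) ^ 3 - 0) / norm (y - 0)"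
      by (simp add: eventually_at_filter power2_eq_square power3_eq_cube)
    ultimately show "((\<lambda>y::'a. (norm y ^ 3 - norm (0::'a) ^ 3 - 0) /\<^sub>R norm (y - 0)) \<longlongrightarrow> 0) (at 0)"
      using Lim_transform_eventually[of "\<lambda>y::'a. norm y ^ 2" 0]
      by (simp add: divide_inverse_commute)
  qed simp
  with True show ?thesis by (simp add: gderiv_def)
next
  case False
  have "((\<lambda>r::real. r ^ 3) has_real_derivative (3 * norm z ^ 2)) (at (norm z))"
    by (auto intro!: derivative_eq_intros)
  from GDERIV_DERIV_compose[OF GDERIV_norm[OF False] this]
  have "GDERIV (\<lambda>z. norm z ^ 3) z :> (3 * norm z ^ 2) *\<^sub>R sgn z" .
  then show ?thesis
    using False by (simp add: sgn_div_norm power2_eq_square field_simps)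
qed

text \<open>Symmetry of \<open>B\<close> merges the two terms of the product rule for the quadratic
  form. The explicit gradient turns the inexactness condition of \<open>cubic_step\<close> into a
  bound on a residual vector.\<close>

lemma grad_cubic_model:
  fixes B :: "real^'n^'n"
  assumes sym: "transpose B = B"
  shows "grad (cubic_model f B \<sigma> x) y = grad f x + B *v (y - x) + (\<sigma> / 2 * norm (y - x)) *\<^sub>R (y - x)"
proof (rule grad_eqI)
  have 1: "((\<lambda>z. norm (z - x) ^ 3) has_derivative (\<lambda>h. h \<bullet> ((3 * norm (y - x)) *\<^sub>R (y - x)))) (at y)"
    by (rule has_derivative_compose[of "\<lambda>z. z - x" "\<lambda>h. h" y UNIV "\<lambda>z. norm z ^ 3",
          OF _ GDERIV_norm_cube[of "y - x", unfolded gderiv_def]])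
      (auto intro!: derivative_eq_intros)
  have "((\<lambda>z. B *v (z - x)) has_derivative (\<lambda>h. B *v h)) (at y)"
    by (rule bounded_linear.has_derivative[OF matrix_vector_mul_bounded_linear])
      (auto intro!: derivative_eq_intros)
  then have 2: "((\<lambda>z. (B *v (z - x)) \<bullet> (z - x)) has_derivative (\<lambda>h. h \<bullet> (2 *\<^sub>R (B *v (y - x))))) (at y)"
    using dot_lmul_matrix[of "y - x" B] transpose_matrix_vector[of B "y - x"] sym
    by (intro has_derivative_eq_rhs[OF has_derivative_inner[OF _ has_derivative_diff[OF has_derivative_ident has_derivative_const]]])
      (auto simp: fun_eq_iff inner_commute)
  have "((\<lambda>y. grad f x \<bullet> (y - x)) has_derivative (\<lambda>h. grad f x \<bullet> h)) (at y)"
    by (auto intro!: derivative_eq_intros)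
  from has_derivative_add[OF has_derivative_add[OF has_derivative_add[OF has_derivative_const[of "f x"] this]
        has_derivative_mult_right[OF 2, of "1/2"]] has_derivative_mult_right[OF 1, of "\<sigma> / 6"]]
  show "GDERIV (cubic_model f B \<sigma> x) y :> grad f x + B *v (y - x) + (\<sigma> / 2 * norm (y - x)) *\<^sub>R (y - x)"
    unfolding gderiv_def cubic_model_def
    by (rule has_derivative_eq_rhs) (auto simp: fun_eq_iff inner_add_right inner_commute[of "grad f x"])
qed

lemma le_spectral_norm: "norm ((A :: real^'n^'n) *v v) \<le> spectral_norm A * norm v"
  unfolding spectral_norm_def by (intro onorm matrix_vector_mul_bounded_linear)

text \<open>For \<open>w = transpose A *v v\<close> one has
  \<open>w \<bullet> w = v \<bullet> (A *v w)\<close>, and one factor \<open>norm w\<close> cancels.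
  This is needed for the symmetrized difference matrix.\<close>

lemma norm_transpose_mult_le:
  fixes A :: "real^'n^'n"
  assumes "\<And>u. norm (A *v u) \<le> b * norm u" and "b \<ge> 0"
  shows "norm (transpose A *v v) \<le> b * norm v"
proof (cases "transpose A *v v = 0")
  case True
  then show ?thesis using assms(2) by (metis norm_zero mult_nonneg_nonneg norm_ge_zero)
next
  case False
  let ?w = "transpose A *v v"
  have "norm ?w * norm ?w = ?w \<bullet> ?w"
    by (simp add: dot_square_norm power2_eq_square)
  also have "\<dots> = v \<bullet> (A *v ?w)"
    by (simp add: dot_lmul_matrix)
  also have "\<dots> \<le> norm v * norm (A *v ?w)"
    by (rule norm_cauchy_schwarz)
  also have "\<dots> \<le> norm v * (b * norm ?w)"
    by (intro mult_left_mono assms) auto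
  also have "\<dots> = b * norm v * norm ?w"
    by (simp only: mult_ac)
  finally show ?thesis
    using False by (metis mult_right_le_imp_le zero_less_norm_iff)
qed

section \<open>Taylor and finite-difference estimates for a Lipschitz Hessian\<close>

locale lipschitz_hessian =
  fixes f :: "real^'n \<Rightarrow> real" and L :: real
  assumes C2: "twice_cont_differentiable f"
    and L_nonneg: "L \<ge> 0"
    and hess_lipschitz: "spectral_norm (hess f z - hess f y) \<le> L * norm (z - y)"
begin

lemma GDERIV_grad: "GDERIV f x :> grad f x"
  using C2 differentiable_imp_GDERIV_grad unfolding twice_cont_differentiable_def by blast

lemma grad_has_derivative: "(grad f has_derivative (*v) (hess f x)) (at x)"
proof -
  have "grad f differentiable (at x)"
    using C2 unfolding twice_cont_differentiable_def by blast
  then have D: "(grad f has_derivative frechet_derivative (grad f) (at x)) (at x)"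
    by (simp add: frechet_derivative_works)
  then have "linear (frechet_derivative (grad f) (at x))"
    by (rule has_derivative_linear)
  then have "(*v) (hess f x) = frechet_derivative (grad f) (at x)"
    unfolding hess_def by (auto simp: fun_eq_iff matrix_works)
  with D show ?thesis by simp
qed

lemma hess_diff_le: "norm (hess f z *v v - hess f y *v v) \<le> L * norm (z - y) * norm v"
proof -
  have "norm ((hess f z - hess f y) *v v) \<le> spectral_norm (hess f z - hess f y) * norm v"
    by (rule le_spectral_norm)
  also have "\<dots> \<le> L * norm (z - y) * norm v"
    by (rule mult_right_mono[OF hess_lipschitz]) simp
  finally show ?thesis by (simp add: matrix_vector_mult_diff_rdistrib)
qed

lemma grad_taylor: "norm (grad f (x + d) - grad f x - hess f x *v d) \<le> L / 2 * norm d ^ 2"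
proof -
  define w where "w = grad f (x + d) - grad f x - hess f x *v d"
  define \<phi> where "\<phi> s = w \<bullet> (grad f (x + s *\<^sub>R d) - s *\<^sub>R (hess f x *v d))
    - L / 2 * norm d ^ 2 * norm w * s ^ 2" for s
  have "\<exists>D. (\<phi> has_real_derivative D) (at s) \<and> D \<le> 0" if "0 \<le> s" for s
  proof (intro exI conjI)
    have "((\<lambda>s. x + s *\<^sub>R d) has_derivative (\<lambda>h. h *\<^sub>R d)) (at s)"
      by (auto intro!: derivative_eq_intros)
    from has_derivative_compose[OF this grad_has_derivative]
    have *: "((\<lambda>s. grad f (x + s *\<^sub>R d)) has_derivative (\<lambda>h. h *\<^sub>R (hess f (x + s *\<^sub>R d) *v d))) (at s)"
      by (simp add: matrix_vector_mult_scaleR)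
    show "(\<phi> has_real_derivative
        w \<bullet> (hess f (x + s *\<^sub>R d) *v d - hess f x *v d) - L * norm d ^ 2 * norm w * s) (at s)"
      unfolding \<phi>_def has_field_derivative_def
      by (auto intro!: derivative_eq_intros * simp: fun_eq_iff algebra_simps inner_diff_right)
    have "w \<bullet> (hess f (x + s *\<^sub>R d) *v d - hess f x *v d)
        \<le> norm w * norm (hess f (x + s *\<^sub>R d) *v d - hess f x *v d)"
      by (rule norm_cauchy_schwarz)
    also have "\<dots> \<le> norm w * (L * norm (s *\<^sub>R d) * norm d)"
      using hess_diff_le[of "x + s *\<^sub>R d" d x] by (intro mult_left_mono) auto
    finally show "w \<bullet> (hess f (x + s *\<^sub>R d) *v d - hess f x *v d) - L * norm d ^ 2 * norm w * s \<le> 0"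
      using that by (simp add: power2_eq_square mult_ac)
  qed
  from DERIV_nonpos_imp_nonincreasing[OF zero_le_one this]
  have "\<phi> 1 \<le> \<phi> 0" by simp
  then have "w \<bullet> w \<le> L / 2 * norm d ^ 2 * norm w"
    unfolding \<phi>_def w_def by (simp add: inner_diff_right)
  then have "norm w * norm w \<le> L / 2 * norm d ^ 2 * norm w"
    by (simp add: dot_square_norm power2_eq_square)
  then show ?thesis
    unfolding w_def[symmetric] using L_nonneg
    by (cases "w = 0") (simp, metis mult_right_le_imp_le zero_less_norm_iff)
qed

text \<open>The same monotonicity argument one order higher: the derivative of \<open>\<phi>\<close>
  is controlled by \<open>grad_taylor\<close> for the shortened step
  \<open>s *\<^sub>R d\<close>.\<close>

lemma taylor_le: "f (x + d) \<le> f x + grad f x \<bullet> d + (hess f x *v d) \<bullet> d / 2 + L / 6 * norm d ^ 3"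
proof -
  define \<phi> where "\<phi> s = f (x + s *\<^sub>R d) - s * (grad f x \<bullet> d) - s ^ 2 / 2 * ((hess f x *v d) \<bullet> d)
    - L / 6 * norm d ^ 3 * s ^ 3" for s
  have "\<exists>D. (\<phi> has_real_derivative D) (at s) \<and> D \<le> 0" if "0 \<le> s" for s
  proof (intro exI conjI)
    let ?r = "grad f (x + s *\<^sub>R d) - grad f x - hess f x *v (s *\<^sub>R d)"
    show "(\<phi> has_real_derivative ?r \<bullet> d - L / 2 * norm d ^ 3 * s ^ 2) (at s)"
      unfolding \<phi>_def
      by (auto intro!: derivative_eq_intros DERIV_along_line[OF GDERIV_grad]
          simp: algebra_simps inner_diff_left matrix_vector_mult_scaleR)
    have "?r \<bullet> d \<le> norm ?r * norm d"
      by (rule norm_cauchy_schwarz)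
    also have "\<dots> \<le> L / 2 * norm (s *\<^sub>R d) ^ 2 * norm d"
      by (intro mult_right_mono grad_taylor) auto
    finally show "?r \<bullet> d - L / 2 * norm d ^ 3 * s ^ 2 \<le> 0"
      by (simp add: power2_eq_square power3_eq_cube mult_ac)
  qed
  from DERIV_nonpos_imp_nonincreasing[OF zero_le_one this]
  have "\<phi> 1 \<le> \<phi> 0" by simp
  then show ?thesis
    unfolding \<phi>_def by simp
qed

text \<open>The second difference is symmetric in \<open>u\<close> and \<open>v\<close>, hence so is the Hessian.\<close>

lemma mixed_difference_le:
  assumes "t > 0"
  shows "\<bar>f (x + t *\<^sub>R u + t *\<^sub>R v) - f (x + t *\<^sub>R u) - f (x + t *\<^sub>R v) + f x - t\<^sup>2 * ((hess f x *v u) \<bullet> v)\<bar>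
    \<le> t ^ 3 * (L * (norm u + norm v) ^ 3)"
proof -
  \<comment> \<open>The mean value theorem in direction \<open>v\<close> is applied to the
    difference in direction \<open>u\<close>. Two gradient expansions at \<open>x\<close> then bring
    in the Hessian, and their remainders are of order \<open>t\<^sup>2\<close>.\<close>
  define \<phi> where "\<phi> s = f (x + t *\<^sub>R u + s *\<^sub>R v) - f (x + s *\<^sub>R v)" for s
  have "(\<phi> has_real_derivative (grad f (x + t *\<^sub>R u + s *\<^sub>R v) - grad f (x + s *\<^sub>R v)) \<bullet> v) (at s)" for s
    unfolding \<phi>_def inner_diff_left
    by (intro DERIV_diff DERIV_along_line[OF GDERIV_grad])
  from MVT2[OF assms this] obtain \<xi> where \<xi>: "0 < \<xi>" "\<xi> < t"
    and eq: "\<phi> t - \<phi> 0 = t * ((grad f (x + t *\<^sub>R u + \<xi> *\<^sub>R v) - grad f (x + \<xi> *\<^sub>R v)) \<bullet> v)"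
    by (metis diff_zero)
  let ?a = "t *\<^sub>R u + \<xi> *\<^sub>R v" and ?N = "norm u + norm v"
  let ?r1 = "grad f (x + ?a) - grad f x - hess f x *v ?a"
  let ?r2 = "grad f (x + \<xi> *\<^sub>R v) - grad f x - hess f x *v (\<xi> *\<^sub>R v)"
  have "\<xi> * norm v \<le> t * norm v"
    using \<xi> by (intro mult_right_mono) auto
  then have na: "norm ?a \<le> t * ?N"
    using norm_triangle_ineq[of "t *\<^sub>R u" "\<xi> *\<^sub>R v"] \<xi> assms by (simp add: algebra_simps)
  have nv: "norm (\<xi> *\<^sub>R v) \<le> t * ?N"
    using \<open>\<xi> * norm v \<le> t * norm v\<close> \<xi> assms by (simp add: algebra_simps add_increasing)
  have tail: "L / 2 * norm e ^ 2 \<le> L / 2 * (t * ?N) ^ 2" if "norm e \<le> t * ?N" for e :: "real^'n"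
    using that L_nonneg by (intro mult_left_mono power_mono) auto
  have "norm (?r1 - ?r2) \<le> L * (t * ?N) ^ 2"
    using norm_triangle_ineq4[of ?r1 ?r2] grad_taylor[of x ?a] grad_taylor[of x "\<xi> *\<^sub>R v"]
      tail[OF na] tail[OF nv] by linarith
  moreover have "norm v \<le> ?N" by simp
  ultimately have "norm (?r1 - ?r2) * norm v \<le> L * (t * ?N) ^ 2 * ?N"
    using L_nonneg by (intro mult_mono) auto
  then have "\<bar>(?r1 - ?r2) \<bullet> v\<bar> \<le> L * (t * ?N) ^ 2 * ?N"
    using Cauchy_Schwarz_ineq2[of "?r1 - ?r2" v] by linarith
  then have *: "t * \<bar>(?r1 - ?r2) \<bullet> v\<bar> \<le> t * (L * (t * ?N) ^ 2 * ?N)"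
    using assms by (intro mult_left_mono) auto
  have "f (x + t *\<^sub>R u + t *\<^sub>R v) - f (x + t *\<^sub>R u) - f (x + t *\<^sub>R v) + f x = \<phi> t - \<phi> 0"
    unfolding \<phi>_def by simp
  also have "\<dots> = t * ((?r1 - ?r2) \<bullet> v) + t\<^sup>2 * ((hess f x *v u) \<bullet> v)"
    unfolding eq
    by (simp add: algebra_simps inner_diff_left inner_add_left matrix_vector_mult_scaleR
        matrix_vector_right_distrib power2_eq_square)
  finally have "\<bar>f (x + t *\<^sub>R u + t *\<^sub>R v) - f (x + t *\<^sub>R u) - f (x + t *\<^sub>R v) + f x - t\<^sup>2 * ((hess f x *v u) \<bullet> v)\<bar>
      = t * \<bar>(?r1 - ?r2) \<bullet> v\<bar>"
    using assms by (simp add: abs_mult)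
  with * show ?thesis
    by (simp add: power2_eq_square power3_eq_cube mult_ac)
qed

text \<open>Both orders of \<open>u\<close> and \<open>v\<close> approximate the same second
  difference up to order \<open>t ^ 3\<close>. After division by \<open>t\<^sup>2\<close> the
  asymmetry \<open>e\<close> is at most \<open>t * K\<close> for every positive
  \<open>t\<close>.\<close>

lemma hess_self_adjoint: "(hess f x *v u) \<bullet> v = (hess f x *v v) \<bullet> u"
proof -
  define K where "K = 2 * (L * (norm u + norm v) ^ 3)"
  define e where "e = \<bar>(hess f x *v u) \<bullet> v - (hess f x *v v) \<bullet> u\<bar>"
  have K: "K \<ge> 0"
    unfolding K_def using L_nonneg by simp
  have "e \<le> t * K" if "t > 0" for t
  proof -
    have "t\<^sup>2 * e = \<bar>t\<^sup>2 * ((hess f x *v u) \<bullet> v) - t\<^sup>2 * ((hess f x *v v) \<bullet> u)\<bar>"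
      unfolding e_def by (simp add: abs_mult flip: right_diff_distrib)
    also have "\<dots> \<le> t ^ 3 * K"
    proof -
      have "x + t *\<^sub>R v + t *\<^sub>R u = x + t *\<^sub>R u + t *\<^sub>R v" "norm v + norm u = norm u + norm v"
        by simp_all
      then show ?thesis
        using mixed_difference_le[OF that, of x u v] mixed_difference_le[OF that, of x v u]
        unfolding K_def by (simp add: algebra_simps abs_le_iff)
    qed
    finally have "t\<^sup>2 * e \<le> t\<^sup>2 * (t * K)"
      by (simp add: power2_eq_square power3_eq_cube mult_ac)
    with that show ?thesis by simp
  qed
  note le = this
  have "e \<le> 0 + \<delta>" if "\<delta> > 0" for \<delta>
  proof -
    have "e \<le> \<delta> / (K + 1) * K"
      using K that by (intro le) auto
    also have "\<dots> \<le> \<delta>"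
      using K that by (simp add: divide_simps mult_left_mono)
    finally show ?thesis by simp
  qed
  then have "e \<le> 0" by (rule field_le_epsilon)
  then show ?thesis unfolding e_def by simp
qed

text \<open>By \<open>grad_taylor\<close> each column is off by at most \<open>L * h / 2\<close>.
  Cauchy-Schwarz over the columns contributes the square root of the dimension.\<close>

lemma fd_matrix_error:
  assumes "h > 0"
  shows "norm (fd_matrix f x h *v v - hess f x *v v) \<le> sqrt (real CARD('n)) * L * h / 2 * norm v"
proof -
  let ?E = "fd_matrix f x h - hess f x"
  have col: "norm (column i ?E) \<le> L * h / 2" for i
  proof -
    have "h *\<^sub>R column i ?E = grad f (x + h *\<^sub>R axis i 1) - grad f x - hess f x *v (h *\<^sub>R axis i 1)"
      using assms
      by (simp add: vec_eq_iff column_def fd_matrix_def matrix_vector_mult_scaleR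
          matrix_vector_mult_basis right_diff_distrib mult.assoc[symmetric])
    then have "norm (h *\<^sub>R column i ?E) \<le> L / 2 * norm (h *\<^sub>R (axis i 1 :: real^'n)) ^ 2"
      using grad_taylor[of x "h *\<^sub>R axis i 1"] by simp
    then have "h * norm (column i ?E) \<le> h * (L * h / 2)"
      using assms by (simp add: norm_axis_1 power2_eq_square mult_ac)
    with assms show ?thesis by simp
  qed
  have "norm (?E *v v) \<le> (\<Sum>i\<in>UNIV. norm ((v $ i) *s column i ?E))"
    unfolding matrix_mult_sum by (rule norm_sum)
  also have "\<dots> \<le> (\<Sum>i\<in>UNIV. \<bar>v $ i\<bar> * \<bar>L * h / 2\<bar>)"
  proof (rule sum_mono)
    fix i
    have "\<bar>v $ i\<bar> * norm (column i ?E) \<le> \<bar>v $ i\<bar> * \<bar>L * h / 2\<bar>"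
      using col[of i] by (intro mult_left_mono) linarith+
    then show "norm ((v $ i) *s column i ?E) \<le> \<bar>v $ i\<bar> * \<bar>L * h / 2\<bar>"
      by (simp only: scalar_mult_eq_scaleR norm_scaleR)
  qed
  also have "\<dots> \<le> L2_set (\<lambda>i. v $ i) UNIV * L2_set (\<lambda>i::'n. L * h / 2) UNIV"
    by (rule L2_set_mult_ineq)
  also have "\<dots> = sqrt (real CARD('n)) * L * h / 2 * norm v"
  proof -
    have "L2_set (\<lambda>i. v $ i) UNIV = norm v"
      by (simp add: norm_vec_def L2_set_def)
    then show ?thesis using assms L_nonneg by (simp add: L2_set_constant)
  qed
  finally show ?thesis
    by (simp add: matrix_vector_mult_diff_rdistrib)
qed

lemma transpose_hess: "transpose (hess f x) = hess f x"
  unfolding matrix_eq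
proof
  fix u
  have "w \<bullet> (u v* hess f x) = w \<bullet> (hess f x *v u)" for w
    using hess_self_adjoint[of x u w] dot_lmul_matrix[of u "hess f x" w] by (simp add: inner_commute)
  then show "transpose (hess f x) *v u = hess f x *v u"
    unfolding transpose_matrix_vector using vector_eq_ldot by blast
qed

text \<open>As the Hessian is symmetric, the error after symmetrization is the average of
  \<open>E\<close> and its transpose, which obey the same bound.\<close>

lemma fd_hess_error:
  assumes "h > 0"
  shows "norm (fd_hess f x h *v v - hess f x *v v) \<le> sqrt (real CARD('n)) * L * h / 2 * norm v"
proof -
  let ?b = "sqrt (real CARD('n)) * L * h / 2"
  define E where "E = fd_matrix f x h - hess f x"
  have b: "?b \<ge> 0" using assms L_nonneg by simp
  have E: "norm (E *v u) \<le> ?b * norm u" for u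
    using fd_matrix_error[OF assms, of x u] unfolding E_def
    by (simp only: matrix_vector_mult_diff_rdistrib)
  have ET: "transpose E = transpose (fd_matrix f x h) - hess f x"
    using transpose_hess[of x] by (simp add: E_def vec_eq_iff transpose_def)
  have "fd_hess f x h - hess f x = (1/2) *\<^sub>R (E + transpose E)"
    unfolding ET unfolding fd_hess_def E_def by (simp add: vec_eq_iff field_simps)
  then have "(fd_hess f x h - hess f x) *v v = (1/2) *\<^sub>R (E *v v + transpose E *v v)"
    by (simp only: matrix_vector_mult_add_rdistrib scaleR_matrix_vector_assoc[symmetric])
  then have "fd_hess f x h *v v - hess f x *v v = (1/2) *\<^sub>R (E *v v + transpose E *v v)"
    by (simp only: matrix_vector_mult_diff_rdistrib)
  then have "norm (fd_hess f x h *v v - hess f x *v v) = norm (E *v v + transpose E *v v) / 2"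
    by (simp only: norm_scaleR)
  also have "\<dots> \<le> (?b * norm v + ?b * norm v) / 2"
    by (intro divide_right_mono order_trans[OF norm_triangle_ineq] add_mono E norm_transpose_mult_le[OF E b]) simp
  finally show ?thesis by (simp add: mult_ac)
qed

lemma transpose_fd_hess: "transpose (fd_hess f x h) = fd_hess f x h"
  by (simp add: fd_hess_def vec_eq_iff transpose_def add.commute)

end

section \<open>Sums of step lengths\<close>

lemma powr_three_halves: "x \<ge> 0 \<Longrightarrow> x powr (3/2) = sqrt x ^ 3" for x :: real
proof (cases "x = 0")
  case False
  assume "x \<ge> 0"
  with False have "x > 0" by simp
  then have "sqrt x ^ 3 = (x powr (1/2)) powr real 3"
    by (subst powr_realpow) (auto simp: powr_half_sqrt)
  then show ?thesis by (simp add: powr_powr)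
qed simp

text \<open>Each product of two lengths is split into half squares, and every index lies in
  \<open>t - 1\<close> pairs. This controls the Hessian drift in the summed gradient bounds.\<close>

lemma sum_prefix_mult_le:
  fixes u :: "nat \<Rightarrow> real"
  shows "(\<Sum>s<t. (\<Sum>r<s. u r) * u s) \<le> real t / 2 * (\<Sum>s<t. (u s)\<^sup>2)"
proof (induction t)
  case (Suc t)
  have "(\<Sum>r<t. u r) * u t = (\<Sum>r<t. u r * u t)"
    by (rule sum_distrib_right)
  also have "\<dots> \<le> (\<Sum>r<t. (u r)\<^sup>2 / 2 + (u t)\<^sup>2 / 2)"
  proof (rule sum_mono)
    fix r show "u r * u t \<le> (u r)\<^sup>2 / 2 + (u t)\<^sup>2 / 2"
      using sum_squares_bound[of "u r" "u t"] by simp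
  qed
  also have "\<dots> = (\<Sum>r<t. (u r)\<^sup>2) / 2 + real t / 2 * (u t)\<^sup>2"
    by (simp add: sum.distrib sum_divide_distrib)
  finally have "(\<Sum>s<Suc t. (\<Sum>r<s. u r) * u s)
      \<le> real t / 2 * (\<Sum>s<t. (u s)\<^sup>2) + (\<Sum>r<t. (u r)\<^sup>2) / 2 + real t / 2 * (u t)\<^sup>2"
    using Suc by simp
  also have "\<dots> \<le> real (Suc t) / 2 * (\<Sum>s<Suc t. (u s)\<^sup>2)"
    by (simp add: field_simps)
  finally show ?case .
qed simp

text \<open>Young's inequality with exponents 3 and 3/2; three times the gap is the product
  displayed first in the proof.\<close>

lemma mult_square_le_cubes:
  fixes a b :: real
  assumes "a \<ge> 0" "b \<ge> 0"
  shows "a * b\<^sup>2 \<le> a ^ 3 / 3 + 2 / 3 * b ^ 3"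
proof -
  have "0 \<le> (a - b)\<^sup>2 * (a + 2 * b)" using assms by simp
  also have "\<dots> = a ^ 3 - 3 * (a * b\<^sup>2) + 2 * b ^ 3"
    by (simp add: power2_eq_square power3_eq_cube algebra_simps)
  finally show ?thesis by simp
qed

text \<open>Cubic analogue of \<open>sum_prefix_mult_le\<close>, for the Hessian drift in the summed
  decrease. An index receives weight 1/3 from each later one and 2/3 from each earlier one.\<close>

lemma sum_prefix_mult_square_le:
  fixes u :: "nat \<Rightarrow> real"
  assumes "\<And>s. s < t \<Longrightarrow> u s \<ge> 0"
  shows "(\<Sum>s<t. (\<Sum>r<s. u r) * (u s)\<^sup>2) \<le> 2 * real t / 3 * (\<Sum>s<t. u s ^ 3)"
  using assms
proof (induction t)
  case (Suc t)
  have "(\<Sum>r<t. u r) * (u t)\<^sup>2 = (\<Sum>r<t. u r * (u t)\<^sup>2)"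
    by (rule sum_distrib_right)
  also have "\<dots> \<le> (\<Sum>r<t. u r ^ 3 / 3 + 2 / 3 * u t ^ 3)"
    using Suc.prems by (intro sum_mono mult_square_le_cubes) auto
  also have "\<dots> = (\<Sum>r<t. u r ^ 3) / 3 + 2 * real t / 3 * u t ^ 3"
    by (simp add: sum.distrib sum_divide_distrib)
  finally have "(\<Sum>s<Suc t. (\<Sum>r<s. u r) * (u s)\<^sup>2)
      \<le> 2 * real t / 3 * (\<Sum>s<t. u s ^ 3) + (\<Sum>r<t. u r ^ 3) / 3 + 2 * real t / 3 * u t ^ 3"
    using Suc by simp
  also have "\<dots> \<le> 2 * real (Suc t) / 3 * (\<Sum>s<Suc t. u s ^ 3)"
  proof -
    have "0 \<le> (\<Sum>r<t. u r ^ 3)" "0 \<le> u t ^ 3"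
      using Suc.prems by (auto intro!: sum_nonneg)
    then show ?thesis by (simp add: field_simps)
  qed
  finally show ?case .
qed simp

text \<open>The lower bounds on the gradients hold only for the sum over all steps.  Subtracting them with the
  multiplier \<open>q / (100 * p)\<close> leaves an inequality that holds for each step separately.\<close>

lemma descent_pointwise:
  fixes p q d :: real
  assumes "p > 0" "q > 0" "d \<ge> 0"
  shows "q / (100 * p) * (5/6 * p\<^sup>2 * d\<^sup>2 + p * q / 32 * d - q\<^sup>2) + q ^ 3 / (384 * p)
    \<le> p\<^sup>2 / 8 * d ^ 3 - p * q / 64 * d\<^sup>2"
proof -
  \<comment> \<open>Rescaling the length makes both sides multiples of \<open>q ^ 3 / p\<close>,
    leaving a polynomial inequality in \<open>u\<close> alone.\<close>
  define u where "u = p * d / q"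
  have u: "u \<ge> 0" and d: "d = q * u / p" unfolding u_def using assms by auto
  have "1/100 * (5/6 * u\<^sup>2 + u / 32 - 1) + 1/384 \<le> u ^ 3 / 8 - u\<^sup>2 / 64"
  proof -
    \<comment> \<open>The cubic is bounded below by quadratics that touch it at 1/8 and at 1/4;
      \<open>argo\<close> combines these bounds linearly.\<close>
    have "0 \<le> (u - 1/8)\<^sup>2 * (u + 1/16)" using u by simp
    also have "\<dots> = u ^ 3 - 3/16 * u\<^sup>2 + 1 / 1024"
      by (simp add: power2_eq_square power3_eq_cube algebra_simps)
    finally have 1: "3/16 * u\<^sup>2 \<le> u ^ 3 + 1 / 1024" by simp
    have "0 \<le> (u - 1/4)\<^sup>2 * (u + 1/8)" using u by simp
    also have "\<dots> = u ^ 3 - 3/8 * u\<^sup>2 + 1 / 128"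
      by (simp add: power2_eq_square power3_eq_cube algebra_simps)
    finally have 2: "3/8 * u\<^sup>2 \<le> u ^ 3 + 1 / 128" by simp
    have 3: "2 * u \<le> u\<^sup>2 + 1"
      using sum_squares_bound[of u 1] by simp
    have 4: "0 \<le> u\<^sup>2" by simp
    show ?thesis
      using 1 2 3 4 by argo
  qed
  then have "q ^ 3 / p * (1/100 * (5/6 * u\<^sup>2 + u / 32 - 1) + 1/384) \<le> q ^ 3 / p * (u ^ 3 / 8 - u\<^sup>2 / 64)"
    using assms by (intro mult_left_mono) auto
  then show ?thesis
    unfolding d using assms by (simp add: field_simps power2_eq_square power3_eq_cube)
qed

text \<open>Shows that gradients staying above \<open>\<epsilon>\<close> force the decrease required
  after \<open>t\<close> steps. Single steps may decrease too little, so the comparison is made only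
  between sums.\<close>

lemma descent_sum:
  fixes d :: "nat \<Rightarrow> real" and \<sigma> \<epsilon> L b :: real
  assumes pos: "\<sigma> > 0" "\<epsilon> > 0" "L \<ge> 0"
    and L: "13 * (L * real m) \<le> \<sigma>" and b: "b \<le> sqrt (\<sigma> * \<epsilon>) / 32"
    and t: "t \<le> m" and d: "\<And>s. s < t \<Longrightarrow> d s \<ge> 0"
    and large: "\<And>s. s < t \<Longrightarrow>
      \<epsilon> \<le> (3 * \<sigma> / 4 + L / 2) * (d s)\<^sup>2 + L * (\<Sum>r<s. d r) * d s + b * d s"
  shows "\<epsilon> powr (3/2) / (384 * \<sigma> powr (1/2)) * real t
    \<le> (\<Sum>s<t. (\<sigma> - L) / 6 * d s ^ 3 - b / 2 * (d s)\<^sup>2 - L / 2 * (\<Sum>r<s. d r) * (d s)\<^sup>2)"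
proof (cases "t = 0")
  case False
  define p q where "p = sqrt \<sigma>" and "q = sqrt \<epsilon>"
  have p: "p > 0" "p\<^sup>2 = \<sigma>" and q: "q > 0" "q\<^sup>2 = \<epsilon>"
    unfolding p_def q_def using pos by auto
  have b': "b \<le> p * q / 32"
    using b unfolding p_def q_def by (simp add: real_sqrt_mult)
  have powr: "\<epsilon> powr (3/2) / (384 * \<sigma> powr (1/2)) = q ^ 3 / (384 * p)"
    unfolding p_def q_def using pos by (simp add: powr_three_halves powr_half_sqrt)
  define S2 S3 where "S2 = (\<Sum>s<t. (d s)\<^sup>2)" and "S3 = (\<Sum>s<t. d s ^ 3)"
  have S: "S2 \<ge> 0" "S3 \<ge> 0" unfolding S2_def S3_def using d by (auto intro!: sum_nonneg)
  have Lt: "13 * (L * real t) \<le> \<sigma>"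
  proof -
    have "L * real t \<le> L * real m" using t pos by (intro mult_left_mono) auto
    then show ?thesis using L by linarith
  qed
  have L1: "13 * L \<le> \<sigma>"
  proof -
    have "L * 1 \<le> L * real t" using False pos by (intro mult_left_mono) auto
    then show ?thesis using Lt by linarith
  qed
  have A: "0 \<le> (\<Sum>s<t. 5/6 * p\<^sup>2 * (d s)\<^sup>2 + p * q / 32 * d s - q\<^sup>2)"
  proof -
    have "real t * \<epsilon> = (\<Sum>s<t. \<epsilon>)" by simp
    also have "\<dots> \<le> (\<Sum>s<t. (3 * \<sigma> / 4 + L / 2) * (d s)\<^sup>2 + L * (\<Sum>r<s. d r) * d s + b * d s)"
      using large by (intro sum_mono) auto
    also have "\<dots> = (3 * \<sigma> / 4 + L / 2) * S2 + L * (\<Sum>s<t. (\<Sum>r<s. d r) * d s) + b * (\<Sum>s<t. d s)"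
      unfolding S2_def by (simp only: sum.distrib mult.assoc sum_distrib_left[symmetric])
    \<comment> \<open>Both Lipschitz terms cost at most \<open>\<sigma> / 26\<close>, and 3/4 + 2/26
      is below the 5/6 of \<open>descent_pointwise\<close>.\<close>
    also have "\<dots> \<le> (3 * \<sigma> / 4 + \<sigma> / 26) * S2 + \<sigma> / 26 * S2 + p * q / 32 * (\<Sum>s<t. d s)"
    proof (intro add_mono)
      show "(3 * \<sigma> / 4 + L / 2) * S2 \<le> (3 * \<sigma> / 4 + \<sigma> / 26) * S2"
        using L1 S by (intro mult_right_mono) auto
      have "L * (\<Sum>s<t. (\<Sum>r<s. d r) * d s) \<le> L * (real t / 2 * S2)"
        unfolding S2_def by (intro mult_left_mono sum_prefix_mult_le pos)
      also have "\<dots> = (L * real t / 2) * S2" by simp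
      also have "\<dots> \<le> \<sigma> / 26 * S2"
        using Lt S by (intro mult_right_mono) auto
      finally show "L * (\<Sum>s<t. (\<Sum>r<s. d r) * d s) \<le> \<sigma> / 26 * S2" .
      show "b * (\<Sum>s<t. d s) \<le> p * q / 32 * (\<Sum>s<t. d s)"
        using b' d by (intro mult_right_mono sum_nonneg) auto
    qed
    also have "\<dots> \<le> 5/6 * \<sigma> * S2 + p * q / 32 * (\<Sum>s<t. d s)"
    proof -
      have "0 \<le> \<sigma> * S2" using pos S by simp
      then show ?thesis by (simp add: field_simps)
    qed
    finally have "real t * \<epsilon> \<le> 5/6 * \<sigma> * S2 + p * q / 32 * (\<Sum>s<t. d s)" .
    moreover have "(\<Sum>s<t. 5/6 * p\<^sup>2 * (d s)\<^sup>2 + p * q / 32 * d s - q\<^sup>2)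
        = 5/6 * p\<^sup>2 * S2 + p * q / 32 * (\<Sum>s<t. d s) - real t * q\<^sup>2"
      unfolding S2_def
      by (simp only: sum.distrib sum_subtractf sum_distrib_left[symmetric] sum_constant card_lessThan)
    ultimately show ?thesis unfolding p q by simp
  qed
  have "0 \<le> q / (100 * p) * (\<Sum>s<t. 5/6 * p\<^sup>2 * (d s)\<^sup>2 + p * q / 32 * d s - q\<^sup>2)"
    using A p(1) q(1) by (intro mult_nonneg_nonneg) auto
  then have "q ^ 3 / (384 * p) * real t
      \<le> q / (100 * p) * (\<Sum>s<t. 5/6 * p\<^sup>2 * (d s)\<^sup>2 + p * q / 32 * d s - q\<^sup>2) + (\<Sum>s<t. q ^ 3 / (384 * p))"
    by (simp only: sum_constant card_lessThan mult.commute[of "real t"] le_add_same_cancel2)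
  also have "\<dots> = (\<Sum>s<t. q / (100 * p) * (5/6 * p\<^sup>2 * (d s)\<^sup>2 + p * q / 32 * d s - q\<^sup>2) + q ^ 3 / (384 * p))"
    by (simp add: sum.distrib sum_distrib_left)
  also have "\<dots> \<le> (\<Sum>s<t. p\<^sup>2 / 8 * d s ^ 3 - p * q / 64 * (d s)\<^sup>2)"
    using p(1) q(1) d by (intro sum_mono descent_pointwise) auto
  also have "\<dots> = \<sigma> / 8 * S3 - p * q / 64 * S2"
    unfolding p S2_def S3_def by (simp add: sum_subtractf sum_distrib_left)
  \<comment> \<open>The cubic gain is at least 2/13 and the drift takes at most 1/39 of
    \<open>\<sigma> * S3\<close>; the remaining 5/39 exceeds 1/8.\<close>
  also have "\<dots> \<le> (\<sigma> - L) / 6 * S3 - b / 2 * S2 - L / 2 * (\<Sum>s<t. (\<Sum>r<s. d r) * (d s)\<^sup>2)"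
  proof -
    have "L / 2 * (\<Sum>s<t. (\<Sum>r<s. d r) * (d s)\<^sup>2) \<le> L / 2 * (2 * real t / 3 * S3)"
      unfolding S3_def using pos d by (intro mult_left_mono sum_prefix_mult_square_le) auto
    also have "\<dots> = (L * real t / 3) * S3" by simp
    also have "\<dots> \<le> \<sigma> / 39 * S3"
      using Lt S by (intro mult_right_mono) auto
    finally have 1: "L / 2 * (\<Sum>s<t. (\<Sum>r<s. d r) * (d s)\<^sup>2) \<le> \<sigma> / 39 * S3" .
    have "2 * \<sigma> / 13 * S3 \<le> (\<sigma> - L) / 6 * S3"
      using L1 S by (intro mult_right_mono) auto
    moreover have "b / 2 * S2 \<le> p * q / 64 * S2"
      using b' S by (intro mult_right_mono) auto
    moreover have "0 \<le> \<sigma> * S3" using pos S by simp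
    ultimately show ?thesis using 1 by (simp add: field_simps)
  qed
  also have "\<dots> = (\<Sum>s<t. (\<sigma> - L) / 6 * d s ^ 3 - b / 2 * (d s)\<^sup>2 - L / 2 * (\<Sum>r<s. d r) * (d s)\<^sup>2)"
    unfolding S2_def S3_def by (simp only: sum_subtractf mult.assoc sum_distrib_left[symmetric])
  finally show ?thesis unfolding powr .
qed simp

section \<open>Inexact cubic steps\<close>

text \<open>Finiteness of \<open>\<psi>\<close> at both points allows the two subgradient
  inequalities to be added and its values cancelled.\<close>

lemma subdiff_monotone:
  assumes "proper_closed_convex \<psi>" "g \<in> subdiff \<psi> x" "g' \<in> subdiff \<psi> y"
  shows "0 \<le> (g' - g) \<bullet> (y - x)"
proof -
  have fin: "\<psi> z = ereal (real_of_ereal (\<psi> z))" if "z \<in> eff_dom \<psi>" for z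
    using that assms(1) unfolding proper_closed_convex_def eff_dom_def
    by (auto simp: ereal_real)
  have x: "x \<in> eff_dom \<psi>" "\<psi> x + ereal (g \<bullet> (y - x)) \<le> \<psi> y"
    and y: "y \<in> eff_dom \<psi>" "\<psi> y + ereal (g' \<bullet> (x - y)) \<le> \<psi> x"
    using assms(2,3) unfolding subdiff_def by auto
  obtain a b where "\<psi> x = ereal a" "\<psi> y = ereal b"
    using fin x(1) y(1) by metis
  with x(2) y(2) have "a + g \<bullet> (y - x) \<le> b" "b + g' \<bullet> (x - y) \<le> a" by auto
  then show ?thesis by (simp add: inner_diff_left inner_diff_right)
qed

lemma obj_finite:
  assumes "proper_closed_convex \<psi>" "x \<in> eff_dom \<psi>"
  shows "obj f \<psi> x = ereal (real_of_ereal (obj f \<psi> x))"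
    "\<psi> x = ereal (real_of_ereal (obj f \<psi> x) - f x)"
proof -
  obtain r where "\<psi> x = ereal r"
    using assms unfolding proper_closed_convex_def eff_dom_def by (cases "\<psi> x") auto
  then show "obj f \<psi> x = ereal (real_of_ereal (obj f \<psi> x))"
    "\<psi> x = ereal (real_of_ereal (obj f \<psi> x) - f x)"
    by (auto simp: obj_def)
qed

text \<open>Models one call of the procedure: \<open>B\<close> and \<open>\<sigma>\<close> are fixed
  for all its steps, and the error \<open>b\<close> of \<open>B\<close> refers to the Hessian at the
  starting point \<open>x0\<close>.\<close>

locale inexact_cubic_steps = lipschitz_hessian f L
  for f :: "real^'n \<Rightarrow> real" and L :: real +
  fixes \<psi> :: "real^'n \<Rightarrow> ereal" and B :: "real^'n^'n" and b \<sigma> :: real and x0 :: "real^'n"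
  assumes proper: "proper_closed_convex \<psi>"
    and B_sym: "transpose B = B"
    and B_error: "norm (B *v v - hess f x0 *v v) \<le> b * norm v"
    and sigma_pos: "\<sigma> > 0"
begin

abbreviation F :: "real^'n \<Rightarrow> real" where "F y \<equiv> real_of_ereal (obj f \<psi> y)"

section \<open>Estimates for a single inexact step\<close>

lemma B_hess_le: "norm (B *v d - hess f x *v d) \<le> (L * norm (x - x0) + b) * norm d"
  using norm_triangle_ineq[of "B *v d - hess f x0 *v d" "hess f x0 *v d - hess f x *v d"]
    B_error[of d] hess_diff_le[of x0 d x]
  by (simp add: algebra_simps norm_minus_commute)

text \<open>The accepted model value is at most the old objective. By \<open>taylor_le\<close>,
  \<open>f y\<close> exceeds the model by at most the Hessian error plus a cubic term with factor
  \<open>(L - \<sigma>) / 6\<close>.\<close>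

lemma cubic_step_decrease:
  assumes step: "cubic_step f \<psi> B \<sigma> x y g" and x: "x \<in> eff_dom \<psi>"
  shows "(\<sigma> - L) / 6 * norm (y - x) ^ 3 - b / 2 * (norm (y - x))\<^sup>2
    - L / 2 * norm (x - x0) * (norm (y - x))\<^sup>2 \<le> F x - F y"
proof -
  define d where "d = y - x"
  have y: "y \<in> eff_dom \<psi>" and "ereal (cubic_model f B \<sigma> x y) + \<psi> y \<le> obj f \<psi> x"
    using step unfolding cubic_step_def by auto
  then have "ereal (cubic_model f B \<sigma> x y) + ereal (F y - f y) \<le> ereal (F x)"
    using obj_finite[OF proper x, of f] obj_finite[OF proper y, of f] by metis
  then have "cubic_model f B \<sigma> x y + (F y - f y) \<le> F x"
    by simp
  moreover have "f y \<le> f x + grad f x \<bullet> d + (hess f x *v d) \<bullet> d / 2 + L / 6 * norm d ^ 3"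
    using taylor_le[of x d] unfolding d_def by simp
  moreover have "(hess f x *v d) \<bullet> d - (B *v d) \<bullet> d \<le> L * norm (x - x0) * (norm d)\<^sup>2 + b * (norm d)\<^sup>2"
  proof -
    have "(hess f x *v d) \<bullet> d - (B *v d) \<bullet> d = (hess f x *v d - B *v d) \<bullet> d"
      by (simp add: inner_diff_left)
    also have "\<dots> \<le> norm (hess f x *v d - B *v d) * norm d"
      by (rule norm_cauchy_schwarz)
    also have "\<dots> \<le> ((L * norm (x - x0) + b) * norm d) * norm d"
      using B_hess_le[of d x] by (intro mult_right_mono) (auto simp: norm_minus_commute)
    finally show ?thesis by (simp add: algebra_simps power2_eq_square)
  qed
  ultimately show ?thesis
    unfolding cubic_model_def d_def[symmetric] by (simp add: algebra_simps diff_divide_distrib)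
qed

text \<open>The new gradient is the model residual plus Taylor remainder, plus Hessian error, minus
  the gradient of the cubic term. The factor 3/4 is 1/4 from the inexactness and 1/2 from the cubic
  term.\<close>

lemma cubic_step_gradient:
  assumes "cubic_step f \<psi> B \<sigma> x y g"
  shows "norm (grad f y + g) \<le> (3 * \<sigma> / 4 + L / 2) * (norm (y - x))\<^sup>2
    + L * norm (x - x0) * norm (y - x) + b * norm (y - x)"
proof -
  define d where "d = y - x"
  define r where "r = grad f x + B *v d + (\<sigma> / 2 * norm d) *\<^sub>R d + g"
  have r: "norm r \<le> \<sigma> / 4 * (norm d)\<^sup>2"
    using assms unfolding cubic_step_def grad_cubic_model[OF B_sym] r_def d_def by simp
  have t: "norm (grad f y - grad f x - hess f x *v d) \<le> L / 2 * (norm d)\<^sup>2"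
    using grad_taylor[of x d] unfolding d_def by simp
  have h: "norm (hess f x *v d - B *v d) \<le> (L * norm (x - x0) + b) * norm d"
    using B_hess_le[of d x] by (simp add: norm_minus_commute)
  have c: "norm ((\<sigma> / 2 * norm d) *\<^sub>R d) = \<sigma> / 2 * (norm d)\<^sup>2"
    using sigma_pos by (simp add: power2_eq_square)
  have eq: "grad f y + g = (r + (grad f y - grad f x - hess f x *v d))
      + ((hess f x *v d - B *v d) - (\<sigma> / 2 * norm d) *\<^sub>R d)"
    unfolding r_def by simp
  have "norm (grad f y + g) \<le> (norm r + norm (grad f y - grad f x - hess f x *v d))
      + (norm (hess f x *v d - B *v d) + norm ((\<sigma> / 2 * norm d) *\<^sub>R d))"
    unfolding eq by (intro norm_triangle_mono norm_triangle_ineq norm_triangle_ineq4)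
  also have "\<dots> \<le> (\<sigma> / 4 * (norm d)\<^sup>2 + L / 2 * (norm d)\<^sup>2)
      + ((L * norm (x - x0) + b) * norm d + \<sigma> / 2 * (norm d)\<^sup>2)"
    using r t h c by (intro add_mono) auto
  finally show ?thesis
    unfolding d_def[symmetric] by (simp add: algebra_simps)
qed

text \<open>The residual is tested against the step \<open>d\<close>. The cubic term outweighs the
  inexactness, and monotonicity removes the change of subgradient. The curvature is that of
  \<open>B\<close>, so it is compared with the Hessian at \<open>x0\<close>, and the distance of
  \<open>x\<close> from \<open>x0\<close> does not enter.\<close>

lemma cubic_step_length:
  assumes step: "cubic_step f \<psi> B \<sigma> x y g" and g: "gx \<in> subdiff \<psi> x"
    and convex: "loewner_le (mat \<mu>) (hess f x0)"
  shows "(\<mu> - b) * norm (y - x) \<le> norm (grad f x + gx)"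
proof (cases "y = x")
  case False
  define d where "d = y - x"
  define r where "r = grad f x + B *v d + (\<sigma> / 2 * norm d) *\<^sub>R d + g"
  have d: "norm d > 0" using False unfolding d_def by simp
  have r: "norm r \<le> \<sigma> / 4 * (norm d)\<^sup>2" and gy: "g \<in> subdiff \<psi> y"
    using step unfolding cubic_step_def grad_cubic_model[OF B_sym] r_def d_def by simp_all
  have "r \<bullet> d \<le> norm r * norm d"
    by (rule norm_cauchy_schwarz)
  also have "\<dots> \<le> \<sigma> / 4 * (norm d)\<^sup>2 * norm d"
    using r by (intro mult_right_mono) auto
  finally have 1: "r \<bullet> d \<le> \<sigma> / 4 * (norm d)\<^sup>2 * norm d" .
  have 2: "0 \<le> (g - gx) \<bullet> d"
    using subdiff_monotone[OF proper g gy] unfolding d_def .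
  have 3: "- (norm (grad f x + gx) * norm d) \<le> (grad f x + gx) \<bullet> d"
    using Cauchy_Schwarz_ineq2[of "grad f x + gx" d] by linarith
  have "mat \<mu> = \<mu> *\<^sub>R (mat 1 :: real^'n^'n)"
    by (simp add: vec_eq_iff mat_def)
  then have "(mat \<mu> :: real^'n^'n) *v d = \<mu> *\<^sub>R d"
    by (simp only: scaleR_matrix_vector_assoc[symmetric] matrix_vector_mul_lid)
  then have 4: "\<mu> * (norm d)\<^sup>2 \<le> (hess f x0 *v d) \<bullet> d"
    using convex unfolding loewner_le_def by (metis inner_commute inner_scaleR_right dot_square_norm)
  have "(hess f x0 *v d) \<bullet> d - (B *v d) \<bullet> d = (hess f x0 *v d - B *v d) \<bullet> d"
    by (simp add: inner_diff_left)
  also have "\<dots> \<le> norm (hess f x0 *v d - B *v d) * norm d"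
    by (rule norm_cauchy_schwarz)
  also have "\<dots> \<le> (b * norm d) * norm d"
    using B_error[of d] by (intro mult_right_mono) (auto simp: norm_minus_commute)
  finally have 5: "(hess f x0 *v d) \<bullet> d - (B *v d) \<bullet> d \<le> b * norm d * norm d" .
  have "r \<bullet> d = (grad f x + gx) \<bullet> d + (g - gx) \<bullet> d + (B *v d) \<bullet> d + \<sigma> / 2 * (norm d)\<^sup>2 * norm d"
    unfolding r_def
    by (simp add: inner_add_left inner_diff_left dot_square_norm power2_eq_square)
  moreover have "0 \<le> \<sigma> * (norm d)\<^sup>2 * norm d" using sigma_pos by simp
  ultimately have "\<mu> * (norm d)\<^sup>2 - b * norm d * norm d \<le> norm (grad f x + gx) * norm d"
    using 1 2 3 4 5 by linarith
  then have "((\<mu> - b) * norm d) * norm d \<le> norm (grad f x + gx) * norm d"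
    by (simp add: algebra_simps power2_eq_square)
  then have "(\<mu> - b) * norm d \<le> norm (grad f x + gx)"
    using d by (rule mult_right_le_imp_le)
  then show ?thesis unfolding d_def .
qed simp

section \<open>Whole runs of the procedure\<close>

text \<open>Preservation may assume a gradient above \<open>\<epsilon>\<close>, since otherwise the
  run ends with a solution. On a halt the rejected point has already been computed, so the invariant
  holds there with counter \<open>Suc t\<close>.\<close>

lemma cubic_steps_from_invariant:
  assumes run: "cubic_steps_from f \<psi> B \<sigma> m \<epsilon> x0 t x r" and init: "I t x"
    and pres: "\<And>t x y g. I t x \<Longrightarrow> t \<noteq> m \<Longrightarrow> cubic_step f \<psi> B \<sigma> x y g \<Longrightarrow> \<epsilon> < norm (grad f y + g)
      \<Longrightarrow> I (Suc t) y"
  shows "case r of (y, Success) \<Rightarrow> I m y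
    | (y, Solution) \<Rightarrow> \<exists>g\<in>subdiff \<psi> y. norm (grad f y + g) \<le> \<epsilon>
    | (y, Halt) \<Rightarrow> \<exists>t. t \<noteq> m \<and> I (Suc t) y \<and> \<not> obj f \<psi> x0 - obj f \<psi> y
          \<ge> ereal (\<epsilon> powr (3/2) / (384 * \<sigma> powr (1/2)) * real (t + 1))"
  using run init
proof (induction rule: cubic_steps_from.induct)
  case (solution t x y g)
  then show ?case by (auto simp: cubic_step_def)
next
  case (continue t x y g r)
  have "I (t + 1) y"
    using pres[OF continue.prems continue.hyps(1,2)] continue.hyps(3) by simp
  then show ?case by (rule continue.IH)
next
  case (halt t x y g)
  have "I (Suc t) y"
    using halt.hyps(1-3) halt.prems by (intro pres) auto
  then show ?case using halt.hyps by auto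
qed simp

text \<open>The invariant collects the step lengths with all hypotheses of
  \<open>descent_sum\<close>. At a halt, the decrease test that failed would therefore be
  satisfied.\<close>

lemma no_halt:
  assumes run: "cubic_steps f \<psi> x0 B \<sigma> m \<epsilon> (y, s)" and x0: "x0 \<in> eff_dom \<psi>"
    and "\<epsilon> > 0" and "13 * (L * real m) \<le> \<sigma>" and "b \<le> sqrt (\<sigma> * \<epsilon>) / 32"
  shows "s \<noteq> Halt"
proof
  assume s: "s = Halt"
  \<comment> \<open>\<open>d s\<close> is the length of step \<open>s\<close>\<close>
  define I where "I t x \<longleftrightarrow> t \<le> m \<and> x \<in> eff_dom \<psi> \<and> (\<exists>d. (\<forall>s<t. d s \<ge> 0) \<and>
      (\<forall>s<t. \<epsilon> \<le> (3 * \<sigma> / 4 + L / 2) * (d s)\<^sup>2 + L * (\<Sum>r<s. d r) * d s + b * d s) \<and>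
      (\<Sum>s<t. (\<sigma> - L) / 6 * d s ^ 3 - b / 2 * (d s)\<^sup>2 - L / 2 * (\<Sum>r<s. d r) * (d s)\<^sup>2) \<le> F x0 - F x \<and>
      norm (x - x0) \<le> (\<Sum>s<t. d s))" for t x
  have "I 0 x0" unfolding I_def using x0 by simp
  moreover have "I (Suc t) y" if I: "I t x" and m: "t \<noteq> m" and step: "cubic_step f \<psi> B \<sigma> x y g"
    and g: "\<epsilon> < norm (grad f y + g)" for t x y g
  proof -
    obtain d where t: "t \<le> m" and x: "x \<in> eff_dom \<psi>" and d: "\<forall>s<t. d s \<ge> 0"
      and grad: "\<forall>s<t. \<epsilon> \<le> (3 * \<sigma> / 4 + L / 2) * (d s)\<^sup>2 + L * (\<Sum>r<s. d r) * d s + b * d s"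
      and dec: "(\<Sum>s<t. (\<sigma> - L) / 6 * d s ^ 3 - b / 2 * (d s)\<^sup>2 - L / 2 * (\<Sum>r<s. d r) * (d s)\<^sup>2) \<le> F x0 - F x"
      and dist: "norm (x - x0) \<le> (\<Sum>s<t. d s)"
      using I unfolding I_def by (elim conjE exE) (rule that)
    define e where "e = d(t := norm (y - x))"
    have e: "e s = d s" if "s < t" for s using that unfolding e_def by simp
    have et: "e t = norm (y - x)" unfolding e_def by simp
    have sums: "(\<Sum>r<s. e r) = (\<Sum>r<s. d r)" if "s \<le> t" for s
      using that by (intro sum.cong) (auto simp: e)
    have dist': "L * norm (x - x0) \<le> L * (\<Sum>r<t. d r)"
      using dist L_nonneg by (rule mult_left_mono)
    have "y \<in> eff_dom \<psi>" using step unfolding cubic_step_def by blast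
    moreover have "\<forall>s<Suc t. e s \<ge> 0"
      using d by (auto simp: less_Suc_eq e et)
    moreover have "\<epsilon> \<le> (3 * \<sigma> / 4 + L / 2) * (e t)\<^sup>2 + L * (\<Sum>r<t. e r) * e t + b * e t"
      using g cubic_step_gradient[OF step] mult_right_mono[OF dist', of "norm (y - x)"]
      unfolding et sums[OF order_refl] by simp
    then have "\<forall>s<Suc t. \<epsilon> \<le> (3 * \<sigma> / 4 + L / 2) * (e s)\<^sup>2 + L * (\<Sum>r<s. e r) * e s + b * e s"
      using grad by (auto simp: less_Suc_eq e sums)
    moreover have "(\<Sum>s<Suc t. (\<sigma> - L) / 6 * e s ^ 3 - b / 2 * (e s)\<^sup>2 - L / 2 * (\<Sum>r<s. e r) * (e s)\<^sup>2) \<le> F x0 - F y"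
    proof -
      have "(\<Sum>s<t. (\<sigma> - L) / 6 * e s ^ 3 - b / 2 * (e s)\<^sup>2 - L / 2 * (\<Sum>r<s. e r) * (e s)\<^sup>2)
          = (\<Sum>s<t. (\<sigma> - L) / 6 * d s ^ 3 - b / 2 * (d s)\<^sup>2 - L / 2 * (\<Sum>r<s. d r) * (d s)\<^sup>2)"
        by (intro sum.cong) (auto simp: e sums)
      moreover have "L / 2 * norm (x - x0) * (norm (y - x))\<^sup>2 \<le> L / 2 * (\<Sum>r<t. d r) * (norm (y - x))\<^sup>2"
        using dist' by (intro mult_right_mono) auto
      ultimately show ?thesis
        using dec cubic_step_decrease[OF step x] by (simp add: et sums)
    qed
    moreover have "norm (y - x0) \<le> (\<Sum>s<Suc t. e s)"
      using dist norm_triangle_ineq[of "y - x" "x - x0"] by (simp add: et sums)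
    moreover have "Suc t \<le> m" using t m by simp
    ultimately show ?thesis unfolding I_def by (intro conjI exI[of _ e])
  qed
  ultimately obtain t where I: "I (Suc t) y"
    and no: "\<not> obj f \<psi> x0 - obj f \<psi> y \<ge> ereal (\<epsilon> powr (3/2) / (384 * \<sigma> powr (1/2)) * real (t + 1))"
    using cubic_steps_from_invariant[OF run[unfolded cubic_steps_def s], of I] by auto
  obtain d where t: "Suc t \<le> m" and y: "y \<in> eff_dom \<psi>" and d: "\<forall>s<Suc t. d s \<ge> 0"
      and grad: "\<forall>s<Suc t. \<epsilon> \<le> (3 * \<sigma> / 4 + L / 2) * (d s)\<^sup>2 + L * (\<Sum>r<s. d r) * d s + b * d s"
      and dec: "(\<Sum>s<Suc t. (\<sigma> - L) / 6 * d s ^ 3 - b / 2 * (d s)\<^sup>2 - L / 2 * (\<Sum>r<s. d r) * (d s)\<^sup>2) \<le> F x0 - F y"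
      using I unfolding I_def by (elim conjE exE) (rule that)
  have "\<epsilon> powr (3/2) / (384 * \<sigma> powr (1/2)) * real (Suc t) \<le> F x0 - F y"
    using d grad by (intro order_trans[OF descent_sum[OF sigma_pos assms(3) L_nonneg assms(4,5) t] dec]) blast+
  moreover have "obj f \<psi> x0 - obj f \<psi> y = ereal (F x0 - F y)"
    using obj_finite(1)[OF proper x0, of f] obj_finite(1)[OF proper y, of f] by (metis ereal_minus(1))
  ultimately show False using no by simp
qed

text \<open>The gradient bound gains a factor \<open>q\<close> per step, hence \<open>m\<close>
  further powers in a successful run. The number \<open>X\<close> pays for the finite-difference
  error; its contribution to \<open>\<kappa>\<close> is the term with \<open>\<tau>0\<close> in the
  denominator.\<close>

lemma contraction:
  fixes \<mu> X \<kappa> q \<sigma>' :: real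
  assumes run: "cubic_steps f \<psi> x0 B \<sigma> m \<epsilon> (y, Success)"
    and eps: "\<epsilon> > 0" and mu: "\<mu> > 0"
    and convex: "loewner_le (mat \<mu>) (hess f x0)"
    and b: "b \<le> 3 / 8 * \<mu>" "b\<^sup>2 \<le> X * \<epsilon> / 2"
    and sig: "\<sigma> \<le> \<sigma>'" and kappa: "\<kappa> = \<mu>\<^sup>2 / (2 * (6 * \<sigma>' + 8 * L + X))"
    and X: "X \<ge> 0" and q: "0 < q" "q \<le> 1 / 2"
    and g0: "g0 \<in> subdiff \<psi> x0" "norm (grad f x0 + g0) \<le> \<kappa> * q"
  shows "\<exists>g\<in>subdiff \<psi> y. norm (grad f y + g) \<le> \<kappa> * q ^ Suc m"
proof -
  \<comment> \<open>From \<open>b \<le> 3 / 8 * \<mu>\<close>, the curvature left in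
    \<open>cubic_step_length\<close> is at least \<open>5 / 8 * \<mu>\<close>.\<close>
  define a where "a = 8 / (5 * \<mu>)"
  have a: "a > 0" unfolding a_def using mu by simp
  let ?D = "6 * \<sigma>' + 8 * L + X"
  have D: "?D > 0" using sig sigma_pos L_nonneg X by simp
  then have k: "\<kappa> > 0" unfolding kappa using mu by simp
  \<comment> \<open>The distance bound is a partial geometric sum: as \<open>q \<le> 1 / 2\<close>,
    the bounds on the step lengths at least halve each time.\<close>
  define I where "I t x \<longleftrightarrow> norm (x - x0) \<le> 2 * (a * \<kappa> * q) * (1 - (1/2) ^ t) \<and>
    (\<exists>g\<in>subdiff \<psi> x. norm (grad f x + g) \<le> \<kappa> * q ^ Suc t)" for t x
  have "I 0 x0" unfolding I_def using g0 by auto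
  moreover have "I (Suc t) y" if I: "I t x" and step: "cubic_step f \<psi> B \<sigma> x y g"
    and g: "\<epsilon> < norm (grad f y + g)" for t x y g
  proof -
    define d where "d = norm (y - x)"
    have d0: "d \<ge> 0" unfolding d_def by simp
    from I obtain gx where dist: "norm (x - x0) \<le> 2 * (a * \<kappa> * q) * (1 - (1/2) ^ t)"
      and gx: "gx \<in> subdiff \<psi> x" "norm (grad f x + gx) \<le> \<kappa> * q ^ Suc t"
      unfolding I_def by blast
    have "5 / 8 * \<mu> * d \<le> (\<mu> - b) * d"
      using b d0 by (intro mult_right_mono) auto
    also have "\<dots> \<le> \<kappa> * q ^ Suc t"
      using cubic_step_length[OF step gx(1) convex] gx(2) unfolding d_def by linarith
    finally have d: "d \<le> a * \<kappa> * q ^ Suc t"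
      unfolding a_def using mu by (simp add: field_simps)
    have "q ^ t \<le> (1/2) ^ t"
      using q by (intro power_mono) auto
    then have "a * \<kappa> * q * q ^ t \<le> a * \<kappa> * q * (1/2) ^ t"
      using a k q by (intro mult_left_mono) auto
    then have d': "d \<le> a * \<kappa> * q * (1/2) ^ t"
      using d by (simp add: mult_ac)
    have dist': "norm (y - x0) \<le> 2 * (a * \<kappa> * q) * (1 - (1/2) ^ Suc t)"
      using norm_triangle_ineq[of "y - x" "x - x0"] dist d' unfolding d_def
      by (simp add: algebra_simps)
    have far: "norm (x - x0) \<le> 2 * (a * \<kappa> * q)"
      using dist a k q by (smt (verit) mult_left_le mult_pos_pos zero_less_power)
    \<comment> \<open>Since the gradient at \<open>y\<close> exceeds \<open>\<epsilon>\<close>, the term \<open>\<epsilon> / 2\<close> is absorbed by it below.\<close>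
    have young: "b * d \<le> \<epsilon> / 2 + X / 4 * d\<^sup>2"
    proof -
      have "0 \<le> (\<epsilon> - b * d)\<^sup>2" by simp
      then have "2 * \<epsilon> * (b * d) \<le> \<epsilon>\<^sup>2 + b\<^sup>2 * d\<^sup>2"
        by (simp add: power2_eq_square algebra_simps)
      also have "\<dots> \<le> \<epsilon>\<^sup>2 + X * \<epsilon> / 2 * d\<^sup>2"
        using b by (intro add_left_mono mult_right_mono) auto
      finally have "2 * \<epsilon> * (b * d) \<le> 2 * \<epsilon> * (\<epsilon> / 2 + X / 4 * d\<^sup>2)"
        by (simp add: power2_eq_square algebra_simps)
      then show ?thesis using eps by simp
    qed
    have "norm (grad f y + g) \<le> (3 * \<sigma> / 4 + L / 2) * d\<^sup>2 + L * norm (x - x0) * d + b * d"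
      using cubic_step_gradient[OF step] unfolding d_def .
    also have "\<dots> \<le> (3 * \<sigma> / 4 + L / 2) * d\<^sup>2 + L * norm (x - x0) * d + (norm (grad f y + g) / 2 + X / 4 * d\<^sup>2)"
      using young g by simp
    \<comment> \<open>Half of the gradient norm moves to the left, which doubles the remaining
      coefficients.\<close>
    finally have "norm (grad f y + g) \<le> (3 / 2 * \<sigma> + L + X / 2) * d\<^sup>2 + 2 * L * norm (x - x0) * d"
      by (simp add: algebra_simps)
    \<comment> \<open>In each product one length gets the uniform bound with \<open>q\<close> and
      the other the current bound with \<open>q ^ Suc t\<close>, which yields the extra power of
      \<open>q\<close>.\<close>
    also have "\<dots> \<le> (3 / 2 * \<sigma>' + L + X / 2) * ((a * \<kappa> * q) * (a * \<kappa> * q ^ Suc t)) + 2 * L * (2 * (a * \<kappa> * q)) * (a * \<kappa> * q ^ Suc t)"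
    proof (intro add_mono mult_mono)
      have "a * \<kappa> * q * (1/2) ^ t \<le> a * \<kappa> * q"
        using a k q by (intro mult_left_le) (auto simp: power_le_one)
      then have "d \<le> a * \<kappa> * q" using d' by linarith
      then show "d\<^sup>2 \<le> (a * \<kappa> * q) * (a * \<kappa> * q ^ Suc t)"
        unfolding power2_eq_square using d d0 a k q by (intro mult_mono) auto
    qed (use sig sigma_pos L_nonneg X far d d0 a k q in auto)
    also have "\<dots> = (a\<^sup>2 * \<kappa> * (3 / 2 * \<sigma>' + 5 * L + X / 2)) * (\<kappa> * q ^ Suc (Suc t))"
      by (simp add: power2_eq_square algebra_simps)
    also have "\<dots> \<le> 1 * (\<kappa> * q ^ Suc (Suc t))"
    proof (intro mult_right_mono)
      \<comment> \<open>The factor 32/25 gives the coefficients 1.92, 6.4 and 0.64, all below the 6,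
        8 and 1 in \<open>?D\<close>.\<close>
      have "a\<^sup>2 * \<kappa> = 32 / (25 * ?D)"
        unfolding a_def kappa using mu D by (simp add: field_simps power2_eq_square)
      moreover have "32 / (25 * ?D) * (3 / 2 * \<sigma>' + 5 * L + X / 2) \<le> 1"
        using D L_nonneg X sig sigma_pos by (simp add: field_simps)
      ultimately show "a\<^sup>2 * \<kappa> * (3 / 2 * \<sigma>' + 5 * L + X / 2) \<le> 1"
        by simp
    qed (use k q in auto)
    finally have "norm (grad f y + g) \<le> \<kappa> * q ^ Suc (Suc t)"
      by simp
    moreover have "g \<in> subdiff \<psi> y" using step unfolding cubic_step_def by blast
    ultimately show ?thesis unfolding I_def using dist' by blast
  qed
  ultimately have "I m y"
    using cubic_steps_from_invariant[OF run[unfolded cubic_steps_def], of I] by auto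
  then show ?thesis unfolding I_def by blast
qed

end

section \<open>The first-order method\<close>

text \<open>The bound 13/16 makes the factor \<open>2 ^ 4 * root 3 (2/3)\<close> in
  \<open>cnm_sigma\<close> at least 13, as \<open>no_halt\<close> requires.\<close>

lemma root_3_two_thirds: "13/16 \<le> root 3 (2/3)" "root 3 (2/3) ^ 3 = 2/3"
proof -
  show "root 3 (2/3) ^ 3 = 2/3" by (simp add: odd_real_root_pow)
  have "root 3 ((13/16) ^ 3) \<le> root 3 (2/3)"
    by (subst real_root_le_iff) (auto simp: power3_eq_cube)
  then show "13/16 \<le> root 3 (2/3)" by (simp add: odd_real_root_power_cancel)
qed

text \<open>Here \<open>2 ^ 7 * 192 / 3 = 2 ^ 13\<close>. Working with the cube avoids the
  irrational cube root of \<open>2 ^ 13\<close>.\<close>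

lemma cnm_h_cube:
  assumes "n > 0" "m \<ge> 1" "\<epsilon> > 0" "T > 0"
  shows "cnm_h n m \<epsilon> T > 0"
    and "cnm_h n m \<epsilon> T ^ 3 = (sqrt (cnm_sigma m T * \<epsilon>) / (sqrt (real n) * T)) ^ 3 / 2 ^ 13"
proof -
  have "cnm_sigma m T > 0" unfolding cnm_sigma_def using assms by simp
  then have eq: "3 * cnm_sigma m T powr (3/2) * \<epsilon> powr (3/2) / (2 ^ 7 * 192 * real n powr (3/2) * T ^ 3)
      = (sqrt (cnm_sigma m T * \<epsilon>) / (sqrt (real n) * T)) ^ 3 / 2 ^ 13"
    using assms by (simp add: powr_three_halves real_sqrt_mult power_divide power_mult_distrib mult_ac)
  show "cnm_h n m \<epsilon> T ^ 3 = (sqrt (cnm_sigma m T * \<epsilon>) / (sqrt (real n) * T)) ^ 3 / 2 ^ 13"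
    unfolding cnm_h_def eq by (simp add: odd_real_root_pow)
  show "cnm_h n m \<epsilon> T > 0"
    unfolding cnm_h_def eq using \<open>cnm_sigma m T > 0\<close> assms by simp
qed

text \<open>Puts \<open>kappa\<close> into the form used by \<open>contraction\<close>, with
  regularization at the trial value \<open>2 * max \<tau>0 L\<close>. The lower bound on
  \<open>X\<close> follows by comparing cubes: that of \<open>c\<^sup>2\<close> is
  \<open>1 / (3 * 2 ^ 13)\<close>, twice that of \<open>root 3 (2/3) / 32\<close>.\<close>

lemma kappa_eq:
  assumes "m \<ge> 1" "\<tau>0 > 0" "L \<ge> 0"
  obtains X where "X \<ge> 0" "root 3 (2/3) / 32 * (L\<^sup>2 * real m / \<tau>0) \<le> X"
    "kappa \<mu> L m \<tau>0 = \<mu>\<^sup>2 / (2 * (6 * cnm_sigma m (2 * max \<tau>0 L) + 8 * L + X))"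
proof -
  define c :: real where "c = 1 / (3 powr (1/6) * 2 powr (13/6))"
  have "((3::real) powr (1/6)) ^ 6 = 3" "((2::real) powr (13/6)) ^ 6 = 2 ^ 13"
    by (simp_all add: powr_power powr_numeral)
  then have "c ^ 6 = 1 / (3 * 2 ^ 13)"
    unfolding c_def power_divide power_mult_distrib by simp
  then have "(c\<^sup>2) ^ 3 = 1 / (3 * 2 ^ 13)"
    by (simp flip: power_mult)
  moreover have "(root 3 (2/3) / 32) ^ 3 = 1 / (3 * 2 ^ 14)"
    by (simp add: power_divide root_3_two_thirds)
  ultimately have "(root 3 (2/3) / 32) ^ 3 \<le> (c\<^sup>2) ^ 3"
    by simp
  then have "(root 3 (2/3) / 32) ^ Suc 2 \<le> (c\<^sup>2) ^ Suc 2"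
    unfolding Suc_numeral by simp
  then have "root 3 (2/3) / 32 \<le> c\<^sup>2"
    by (rule power_le_imp_le_base) simp
  then have "root 3 (2/3) / 32 * (L\<^sup>2 * real m / \<tau>0) \<le> c\<^sup>2 * (L\<^sup>2 * real m / \<tau>0)"
    using assms by (intro mult_right_mono) auto
  moreover have "3 * 2 ^ 6 * root 3 (2/3) * real m * max \<tau>0 L + 8 * L + c\<^sup>2 * L\<^sup>2 * real m / \<tau>0
      = 6 * cnm_sigma m (2 * max \<tau>0 L) + 8 * L + c\<^sup>2 * (L\<^sup>2 * real m / \<tau>0)"
    unfolding cnm_sigma_def by simp
  then have "kappa \<mu> L m \<tau>0
      = \<mu>\<^sup>2 / (2 * (6 * cnm_sigma m (2 * max \<tau>0 L) + 8 * L + c\<^sup>2 * (L\<^sup>2 * real m / \<tau>0)))"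
    unfolding kappa_def Let_def c_def[symmetric]
    by (simp only: divide_inverse inverse_mult_distrib mult.assoc)
  ultimately show thesis
    using assms by (intro that[of "c\<^sup>2 * (L\<^sup>2 * real m / \<tau>0)"]) auto
qed

text \<open>The factor \<open>L / T\<close> is kept for two uses: it is at most 1 in trials that
  cannot halt, and its square bounds \<open>b\<^sup>2\<close> in accepted trials.\<close>

lemma (in lipschitz_hessian) inexact_cubic_steps_fd:
  assumes "proper_closed_convex \<psi>" "T > 0" "\<epsilon> > 0" "m \<ge> 1"
  obtains b where "b \<ge> 0" "b \<le> sqrt (cnm_sigma m T * \<epsilon>) / 32 * (L / T)"
    "inexact_cubic_steps f L \<psi> (fd_hess f x (cnm_h CARD('n) m \<epsilon> T)) b (cnm_sigma m T) x"
proof -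
  let ?h = "cnm_h CARD('n) m \<epsilon> T" and ?n = "sqrt (real CARD('n))" and ?s = "sqrt (cnm_sigma m T * \<epsilon>)"
  define b where "b = ?n * L * ?h / 2"
  have sig: "cnm_sigma m T > 0" unfolding cnm_sigma_def using assms by simp
  have n: "?n > 0" by simp
  note h = cnm_h_cube[OF zero_less_card_finite[where 'a = 'n] assms(4,3,2)]
  have "b \<ge> 0" unfolding b_def using h(1) L_nonneg by simp
  moreover have "b \<le> ?s / 32 * (L / T)"
  proof (rule power_le_imp_le_base[of _ 2])
    have "b ^ 3 = (?n * L) ^ 3 * (?s / (?n * T)) ^ 3 / 2 ^ 16"
      unfolding b_def power_divide power_mult_distrib[of _ ?h] h(2) by simp
    also have "\<dots> = (?s * (L / T)) ^ 3 / 2 ^ 16"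
      using n assms(2) by (simp add: power_mult_distrib power_divide)
    \<comment> \<open>Weakening \<open>2 ^ 16\<close> to \<open>2 ^ 15 = 32 ^ 3\<close> makes the
      cube root rational.\<close>
    also have "\<dots> \<le> (?s * (L / T)) ^ 3 / 2 ^ 15"
      using sig assms L_nonneg by (intro divide_left_mono) auto
    also have "\<dots> = (?s / 32 * (L / T)) ^ 3"
      by (simp add: power_mult_distrib power_divide)
    finally show "b ^ Suc 2 \<le> (?s / 32 * (L / T)) ^ Suc 2"
      unfolding Suc_numeral by simp
    show "0 \<le> ?s / 32 * (L / T)" using sig assms L_nonneg by simp
  qed
  moreover have "inexact_cubic_steps f L \<psi> (fd_hess f x ?h) b (cnm_sigma m T) x"
    using assms(1) sig transpose_fd_hess fd_hess_error[OF h(1)] unfolding b_def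
    by unfold_locales auto
  ultimately show thesis by (rule that)
qed

lemma iterate_generated_if_started: "iteration_started \<alpha> k \<Longrightarrow> iterate_generated \<alpha> k"
  by (cases k) auto

section \<open>The double-logarithmic iteration bound\<close>

theorem theorem6p2:
  fixes f :: "real^'n \<Rightarrow> real" and \<psi> :: "real^'n \<Rightarrow> ereal" and F' :: "real^'n \<Rightarrow> real^'n"
    and L \<mu> \<tau>0 \<epsilon> \<kappa> :: real and m :: nat and x0 :: "real^'n"
    and x :: "nat \<Rightarrow> real^'n" and \<tau> :: "nat \<Rightarrow> real"
    and xh :: "nat \<Rightarrow> nat \<Rightarrow> real^'n" and \<alpha> :: "nat \<Rightarrow> nat \<Rightarrow> status"
  assumes "twice_cont_differentiable f"
    and "proper_closed_convex \<psi>"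
    and "(INF y\<in>eff_dom \<psi>. obj f \<psi> y) > -\<infinity>"
    and "subgradient_selection f \<psi> F'"
    and "L \<ge> 0"
    and "\<And>y z. spectral_norm (hess f z - hess f y) \<le> L * norm (z - y)"
    and "\<mu> > 0"
    and "\<And>y. y \<in> eff_dom \<psi> \<Longrightarrow> loewner_le (mat \<mu>) (hess f y)"
    and "\<tau>0 > 0" and "\<epsilon> > 0" and "m \<ge> 1"
    and "\<kappa> = kappa \<mu> L m \<tau>0"
    and "x0 \<in> conv_region f \<psi> F' \<epsilon> \<kappa>"
    and "first_order_cnm f \<psi> x0 \<tau>0 \<epsilon> m x \<tau> xh \<alpha>"
  shows "ereal_of_enat (first_hit f \<psi> \<epsilon> x \<alpha>)
           \<le> ereal (1 / log 2 (1 + real m) * log 2 (log 2 (\<kappa> / \<epsilon>)) + 1)"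
proof -
  interpret lipschitz_hessian f L
    using assms(1,5,6) by unfold_locales auto
  note proper = assms(2) and strong = assms(8) and eps = assms(10) and run = assms(14)
  define r where "r = root 3 (2/3)"
  have r: "13/16 \<le> r" unfolding r_def by (rule root_3_two_thirds)
  have sigma: "cnm_sigma m T = 16 * r * T * real m" for T
    unfolding cnm_sigma_def r_def by simp
  obtain X where X: "X \<ge> 0" "r / 32 * (L\<^sup>2 * real m / \<tau>0) \<le> X"
    and kappa: "\<kappa> = \<mu>\<^sup>2 / (2 * (6 * cnm_sigma m (2 * max \<tau>0 L) + 8 * L + X))"
    using kappa_eq[OF assms(11,9,5)] assms(12) unfolding r_def by metis
  let ?D = "6 * cnm_sigma m (2 * max \<tau>0 L) + 8 * L + X"
  have D: "?D > X"
    unfolding sigma using r assms(5,9,11) by (auto intro!: add_pos_nonneg mult_pos_pos)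
  have kpos: "\<kappa> > 0" unfolding kappa using D X assms(7) by simp
  have kX: "\<kappa> * X \<le> \<mu>\<^sup>2 / 2"
  proof -
    have "\<kappa> * X \<le> \<kappa> * ?D" using D kpos by simp
    also have "\<dots> = \<mu>\<^sup>2 / 2" unfolding kappa using D X by (simp only: times_divide_eq_left) (simp add: field_simps)
    finally show ?thesis .
  qed
  have x0: "\<epsilon> \<le> norm (F' x0)" "norm (F' x0) \<le> \<kappa> / 2" "obj_subdiff f \<psi> x0 \<noteq> {}"
    using assms(13) unfolding conv_region_def by auto
  have ek: "\<epsilon> \<le> \<kappa> / 2" using x0 by linarith
  have init: "x 0 = x0" "\<tau> 0 = \<tau>0"
    using run unfolding first_order_cnm_def by auto
  define hit where "hit k \<longleftrightarrow> iterate_generated \<alpha> k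
    \<and> (\<exists>g\<in>subdiff \<psi> (x k). norm (grad f (x k) + g) \<le> \<epsilon>)" for k
  \<comment> \<open>The gradient bound is \<open>\<kappa>\<close> times a power of 1/2; a successful
    iteration raises that power of 1/2 to the exponent \<open>m + 1\<close>.\<close>
  define J where "J k \<longleftrightarrow> iteration_started \<alpha> k \<and> \<tau>0 \<le> \<tau> k \<and> \<tau> k \<le> max \<tau>0 L
    \<and> (\<exists>g\<in>subdiff \<psi> (x k). norm (grad f (x k) + g) \<le> \<kappa> * (1/2) ^ ((m + 1) ^ k))" for k
  have J0: "J 0"
  proof -
    have "F' x0 \<in> obj_subdiff f \<psi> x0"
      using assms(4) x0(3) unfolding subgradient_selection_def by blast
    then show ?thesis
      using x0(2) unfolding J_def obj_subdiff_def init by auto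
  qed
  have step: "J (Suc k) \<or> hit (Suc k)" if J: "J k" for k
  proof -
    from J obtain g where started: "iteration_started \<alpha> k" and tau: "\<tau>0 \<le> \<tau> k" "\<tau> k \<le> max \<tau>0 L"
      and g: "g \<in> subdiff \<psi> (x k)" "norm (grad f (x k) + g) \<le> \<kappa> * (1/2) ^ ((m + 1) ^ k)"
      unfolding J_def by blast
    have dom: "x k \<in> eff_dom \<psi>" using g unfolding subdiff_def by blast
    define T where "T l = 2 ^ l * \<tau> k" for l :: nat
    have T: "\<tau>0 \<le> T l" for l
    proof -
      have "1 * \<tau> k \<le> 2 ^ l * \<tau> k"
        using tau assms(9) by (intro mult_right_mono) auto
      then show ?thesis unfolding T_def using tau by simp
    qed
    have Tpos: "T l > 0" for l using T[of l] assms(9) by linarith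
    have trial: "cubic_steps f \<psi> (x k) (fd_hess f (x k) (cnm_h CARD('n) m \<epsilon> (T l)))
        (cnm_sigma m (T l)) m \<epsilon> (xh k l, \<alpha> k l)" if "trial_reached \<alpha> k l" for l
      using run started that unfolding first_order_cnm_def T_def by blast
    have accepted: "x (Suc k) = xh k l"
      "\<alpha> k l = Success \<Longrightarrow> \<tau> (Suc k) = max \<tau>0 (2 powi (int l - 1) * \<tau> k)" if "trial_accepted \<alpha> k l" for l
      using run started that unfolding first_order_cnm_def by blast+
    have not_halt: "\<alpha> k l \<noteq> Halt" if reached: "trial_reached \<alpha> k l" and "L \<le> T l" for l
    proof -
      obtain b where b: "b \<ge> 0" "b \<le> sqrt (cnm_sigma m (T l) * \<epsilon>) / 32 * (L / T l)"
        and "inexact_cubic_steps f L \<psi> (fd_hess f (x k) (cnm_h CARD('n) m \<epsilon> (T l))) b (cnm_sigma m (T l)) (x k)"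
        using inexact_cubic_steps_fd[OF proper Tpos eps assms(11)] by metis
      then interpret inexact_cubic_steps f L \<psi> "fd_hess f (x k) (cnm_h CARD('n) m \<epsilon> (T l))" b
          "cnm_sigma m (T l)" "x k" by simp
      have "13 * (L * real m) \<le> 13 * (T l * real m)"
        using that by (simp add: mult_right_mono)
      also have "\<dots> \<le> 16 * r * (T l * real m)"
        using r Tpos[of l] by (intro mult_right_mono) auto
      finally have "13 * (L * real m) \<le> cnm_sigma m (T l)"
        unfolding sigma by (simp add: mult_ac)
      moreover have "sqrt (cnm_sigma m (T l) * \<epsilon>) / 32 * (L / T l) \<le> sqrt (cnm_sigma m (T l) * \<epsilon>) / 32 * 1"
        using that Tpos[of l] sigma_pos eps by (intro mult_left_mono) auto
      ultimately show ?thesis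
        using no_halt[OF trial[OF reached] dom eps] b by linarith
    qed
    \<comment> \<open>The inner loop ends because the doubled trial values eventually pass
      \<open>L\<close>.\<close>
    have "\<exists>l. \<alpha> k l \<noteq> Halt"
    proof (rule ccontr)
      assume *: "\<not> ?thesis"
      obtain l :: nat where "L / \<tau>0 < 2 ^ l"
        using real_arch_pow[of 2 "L / \<tau>0"] by auto
      then have "L < 2 ^ l * \<tau>0"
        using assms(9) by (simp add: field_simps)
      also have "\<dots> \<le> T l"
        unfolding T_def using tau by simp
      finally show False
        using not_halt[of l] * unfolding trial_reached_def by auto
    qed
    then obtain l where l: "\<alpha> k l \<noteq> Halt" "\<forall>j<l. \<alpha> k j = Halt"
      using exists_least_iff[of "\<lambda>l. \<alpha> k l \<noteq> Halt"] by blast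
    then have acc: "trial_accepted \<alpha> k l" and reached: "trial_reached \<alpha> k l"
      unfolding trial_accepted_def trial_reached_def by auto
    \<comment> \<open>An accepted trial is either the first one or follows a halted one, whose value
      was below \<open>L\<close>.\<close>
    have half: "T l / 2 \<le> max \<tau>0 L"
    proof (cases l)
      case 0
      then show ?thesis unfolding T_def using tau assms(9) by simp
    next
      case (Suc j)
      then have "trial_reached \<alpha> k j" "\<alpha> k j = Halt"
        using l(2) unfolding trial_reached_def by auto
      then have "T j < L" using not_halt[of j] by force
      then show ?thesis unfolding T_def Suc by simp
    qed
    obtain b where b: "b \<ge> 0" "b \<le> sqrt (cnm_sigma m (T l) * \<epsilon>) / 32 * (L / T l)"
      and "inexact_cubic_steps f L \<psi> (fd_hess f (x k) (cnm_h CARD('n) m \<epsilon> (T l))) b (cnm_sigma m (T l)) (x k)"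
      using inexact_cubic_steps_fd[OF proper Tpos eps assms(11)] by metis
    then interpret inexact_cubic_steps f L \<psi> "fd_hess f (x k) (cnm_h CARD('n) m \<epsilon> (T l))" b
        "cnm_sigma m (T l)" "x k" by simp
    have generated: "iterate_generated \<alpha> (Suc k)"
      using started acc by auto
    show ?thesis
    proof (cases "\<alpha> k l = Success")
      case False
      then have "\<alpha> k l = Solution" using l(1) by (cases "\<alpha> k l") auto
      \<comment> \<open>Only the certificate returned with a solution is wanted, so the trivial
        invariant suffices.\<close>
      then have "\<exists>g\<in>subdiff \<psi> (xh k l). norm (grad f (xh k l) + g) \<le> \<epsilon>"
        using cubic_steps_from_invariant[OF trial[OF reached, unfolded cubic_steps_def], of "\<lambda>_ _. True"]
        by simp
      then show ?thesis
        unfolding hit_def accepted(1)[OF acc] using generated by simp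
    next
      case True
      have b2: "b\<^sup>2 \<le> X * \<epsilon> / 2"
      proof -
        have "b\<^sup>2 \<le> (sqrt (cnm_sigma m (T l) * \<epsilon>) / 32 * (L / T l))\<^sup>2"
          using b by (intro power_mono)
        also have "\<dots> = cnm_sigma m (T l) * \<epsilon> / 1024 * (L / T l)\<^sup>2"
          using sigma_pos eps by (simp add: power_mult_distrib power_divide)
        \<comment> \<open>One factor \<open>T l\<close> of \<open>cnm_sigma\<close> cancels, and the
          other is then bounded below by \<open>\<tau>0\<close>.\<close>
        also have "\<dots> = (r / 32 * (L\<^sup>2 * real m / T l)) * \<epsilon> / 2"
          unfolding sigma using Tpos[of l] by (simp add: power2_eq_square field_simps)
        also have "\<dots> \<le> (r / 32 * (L\<^sup>2 * real m / \<tau>0)) * \<epsilon> / 2"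
          using T[of l] r eps assms(9)
          by (intro divide_right_mono mult_right_mono mult_left_mono divide_left_mono) auto
        also have "\<dots> \<le> X * \<epsilon> / 2"
          using X eps by (intro divide_right_mono mult_right_mono) auto
        finally show ?thesis .
      qed
      \<comment> \<open>Membership of \<open>x0\<close> in the region forces
        \<open>\<epsilon> \<le> \<kappa> / 2\<close>, so \<open>b\<^sup>2\<close> is at most
        \<open>\<mu>\<^sup>2 / 8\<close>, slightly below 9/64 of
        \<open>\<mu>\<^sup>2\<close>.\<close>
      have b1: "b \<le> 3 / 8 * \<mu>"
      proof (rule power2_le_imp_le)
        have "X * \<epsilon> \<le> X * (\<kappa> / 2)" using ek X by (intro mult_left_mono)
        then have "b\<^sup>2 \<le> \<mu>\<^sup>2 / 8"
          using b2 kX by (simp add: algebra_simps)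
        also have "\<dots> \<le> 9 / 64 * \<mu>\<^sup>2"
          by simp
        finally show "b\<^sup>2 \<le> (3 / 8 * \<mu>)\<^sup>2"
          by (simp add: power_mult_distrib power_divide)
      qed (use assms(7) in simp)
      have sl: "cnm_sigma m (T l) \<le> cnm_sigma m (2 * max \<tau>0 L)"
        unfolding sigma using half r by (intro mult_right_mono mult_left_mono) auto
      have "(1/2::real) ^ ((m + 1) ^ k) \<le> (1/2) ^ 1"
        by (rule power_decreasing) auto
      then have "\<exists>g\<in>subdiff \<psi> (xh k l). norm (grad f (xh k l) + g) \<le> \<kappa> * ((1/2) ^ ((m + 1) ^ k)) ^ Suc m"
        using trial[OF reached] True
        by (intro contraction[OF _ eps assms(7) strong[OF dom] b1 b2 sl kappa X(1) _ _ g]) auto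
      moreover have "((1/2::real) ^ ((m + 1) ^ k)) ^ Suc m = (1/2) ^ ((m + 1) ^ Suc k)"
        by (simp add: power_mult[symmetric] power_add mult.commute)
      \<comment> \<open>The new estimate comes from half the accepted value, also for
        \<open>l = 0\<close>, so \<open>half\<close> keeps it below
        \<open>max \<tau>0 L\<close>.\<close>
      moreover have "2 powi (int l - 1) * \<tau> k = T l / 2"
        unfolding T_def by (simp add: power_int_diff)
      ultimately have "J (Suc k)"
        unfolding J_def accepted(1)[OF acc] accepted(2)[OF acc True] using started acc True half by auto
      then show ?thesis ..
    qed
  qed
  have J_or_hit: "J k \<or> (\<exists>j\<le>k. hit j)" for k
  proof (induction k)
    case (Suc k)
    then show ?case using step le_Suc_eq by blast
  qed (use J0 in simp)
  define N where "N = 1 / log 2 (1 + real m) * log 2 (log 2 (\<kappa> / \<epsilon>))"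
  have lm: "log 2 (1 + real m) > 0" using assms(11) by simp
  have ratio: "\<kappa> / \<epsilon> \<ge> 2" using ek eps by (simp add: field_simps)
  then have "log 2 (\<kappa> / \<epsilon>) \<ge> 1" by (simp add: le_log_iff)
  then have N: "N \<ge> 0" unfolding N_def using lm by simp
  \<comment> \<open>The integer in the interval from \<open>N\<close>, excluded, to
    \<open>N + 1\<close>, included. A hit by then gives the bound; otherwise two logarithms of the
    gradient bound in \<open>J k\<close> yield \<open>k < N\<close>.\<close>
  define k where "k = nat \<lfloor>N + 1\<rfloor>"
  have k: "real k \<le> N + 1" "N < real k" unfolding k_def using N by linarith+
  have "\<exists>j\<le>k. hit j"
  proof (rule ccontr)
    assume *: "\<not> ?thesis"
    then have "J k" "\<not> hit k" using J_or_hit by blast+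
    then have "\<epsilon> < \<kappa> * (1/2) ^ ((m + 1) ^ k)"
      unfolding J_def hit_def using iterate_generated_if_started by force
    then have "2 ^ ((m + 1) ^ k) < \<kappa> / \<epsilon>"
      using eps by (simp add: field_simps power_one_over)
    then have "log 2 (2 ^ ((m + 1) ^ k)) < log 2 (\<kappa> / \<epsilon>)"
      using kpos eps by (subst log_less_cancel_iff) auto
    moreover have "log 2 (2 ^ ((m + 1) ^ k)) = (1 + real m) ^ k"
      by (subst log_nat_power) (auto simp: add.commute)
    ultimately have "(1 + real m) ^ k < log 2 (\<kappa> / \<epsilon>)"
      by simp
    then have "log 2 ((1 + real m) ^ k) < log 2 (log 2 (\<kappa> / \<epsilon>))"
      by (subst log_less_cancel_iff) (auto intro: less_trans[rotated])
    then have "real k < N"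
      unfolding N_def using lm by (simp add: log_nat_power field_simps)
    with k show False by simp
  qed
  then obtain j where j: "j \<le> k" "hit j" by blast
  then have "first_hit f \<psi> \<epsilon> x \<alpha> \<le> enat j"
    unfolding first_hit_def hit_def by (intro Inf_lower) auto
  then have "ereal_of_enat (first_hit f \<psi> \<epsilon> x \<alpha>) \<le> ereal_of_enat (enat j)"
    by (simp only: ereal_of_enat_le_iff)
  also have "\<dots> \<le> ereal (N + 1)"
    using j(1) k(1) by simp
  finally show ?thesis unfolding N_def .
qed

end
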